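(* Let $\mathcal{P}$ be a symplectic operator and let $\alpha\in\mathbb{C}$. Then $\mathcal{P}(\alpha)$ is symplectic if and only if $2\alpha\in\mathbb{Z}$. Furthermore, if $2\alpha\in\mathbb{Z}$, then $Mon(\mathcal{P})$ is arithmetic if and only if $Mon(\mathcal{P}(\alpha))$ is arithmetic.
   Context: Put $\Theta=t\frac{d}{dt}$. Consider linear differential operators of order $n$ on $\mathbb{P}^1$, $\mathcal{P}=\mathcal{P}(\Theta,t)=\Theta^n+p_{n-1}(t)\Theta^{n-1}+\cdots+p_1(t)\Theta+p_0(t)$ with rational coefficients $p_i(t)\in\mathbb{C}(t)$ written to the left of the powers of $\Theta$. Such an operator is Fuchsian if all its singular points in $\mathbb{P}^1$ are regular singular. Here $n=4$. Shift: for $\alpha\in\mathbb{C}$, the shift of local exponents of $\mathcal{P}$ at $0$ by $\alpha$ is the operator $\mathcal{P}(\alpha):=\mathcal{P}(\Theta-\alpha,t)=(\Theta-\alpha)^n+p_{n-1}(t)(\Theta-\alpha)^{n-1}+\cdots+p_0(t)$. Monodromy: let $\Sigma\subset\mathbb{P}^1$ be a finite set containing the singular points of $\mathcal{P}$ (enlarged by $0$ and $\infty$ if needed), $S=\mathbb{P}^1\setminus\Sigma$, $b\in S$, and $V$ the space of solutions of $\mathcal{P}y=0$ near $b$. Analytic continuation along loops defines the monodromy representation $\pi_1(S,b)\to GL(V)$; its image is the monodromy group $Mon(\mathcal{P})\subset GL(V)\simeq GL(4,\mathbb{C})$. $\mathrm{Sp}(4,\cdot)$ is the symplectic group of the standard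 symplectic form with matrix $\begin{pmatrix}0&1&0&0\\-1&0&0&0\\0&0&0&1\\0&0&-1&0\end{pmatrix}$. A Fuchsian operator is called symplectic if its monodromy group is conjugate (in $GL(4,\mathbb{C})$) to a Zariski-dense subgroup of $\mathrm{Sp}(4,\mathbb{Z})$ (equivalently, Zariski-dense in $\mathrm{Sp}(4,\mathbb{C})$). After identifying the monodromy group with such a subgroup $G\subset\mathrm{Sp}(4,\mathbb{Z})$, it is called arithmetic if the index $[\mathrm{Sp}(4,\mathbb{Z}):G]$ is finite. *)

theory Defs
  imports
    "HOL-Complex_Analysis.Complex_Analysis"
    "HOL-Computational_Algebra.Computational_Algebra"
    "HOL-Computational_Algebra.Field_as_Ring"
    "HOL-Combinatorics.Stirling"
    "HOL-Algebra.Coset"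
begin

section \<open>Rational functions in one complex variable\<close>

type_synonym ratfun = "complex poly fract"

text \<open>
  \<^const>\<open>quot_of_fract\<close> yields a representation by coprime polynomials, so the multiplicity of
  \<open>a\<close> as a root of the denominator is the order of the pole at \<open>a\<close> (0 if there is no pole).
\<close>

definition rf_num :: "ratfun \<Rightarrow> complex poly" where
  "rf_num r = fst (quot_of_fract r)"

definition rf_den :: "ratfun \<Rightarrow> complex poly" where
  "rf_den r = snd (quot_of_fract r)"

definition rf_eval :: "ratfun \<Rightarrow> complex \<Rightarrow> complex" where
  "rf_eval r z = poly (rf_num r) z / poly (rf_den r) z"

definition rf_pole_order :: "complex \<Rightarrow> ratfun \<Rightarrow> nat" where
  "rf_pole_order a r = Polynomial.order a (rf_den r)"

definition rf_of_poly :: "complex poly \<Rightarrow> ratfun" where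
  "rf_of_poly p = Fract p 1"

abbreviation rf_const :: "complex \<Rightarrow> ratfun" where
  "rf_const c \<equiv> rf_of_poly [:c:]"

abbreviation rf_t :: ratfun where
  "rf_t \<equiv> rf_of_poly [:0, 1:]"

text \<open>
  The substitution \<open>r(1/t)\<close>; for a polynomial, \<open>p(1/t) = reflect_poly p (t) / t ^ degree p\<close>.
\<close>

definition rf_reciprocal_arg :: "ratfun \<Rightarrow> ratfun" where
  "rf_reciprocal_arg r =
     (rf_of_poly (reflect_poly (rf_num r)) / rf_t ^ degree (rf_num r)) /
     (rf_of_poly (reflect_poly (rf_den r)) / rf_t ^ degree (rf_den r))"


section \<open>Differential operators\<close>

text \<open>
  The operator \<open>p\<^sub>n(t) \<Theta>\<^sup>n + \<dots> + p\<^sub>0(t)\<close> with \<open>\<Theta> = t d/dt\<close> is encoded as the polynomial in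
  \<open>\<Theta>\<close> with coefficients \<open>p\<^sub>i\<close>, which are understood to stand to the left of the powers of
  \<open>\<Theta>\<close>. The ring multiplication of this type is \<^emph>\<open>not\<close> the composition of operators.
\<close>

type_synonym diffop = "ratfun poly"

definition order4_operator :: "diffop \<Rightarrow> bool" where
  "order4_operator P \<longleftrightarrow> degree P = 4 \<and> lead_coeff P = 1"

definition theta :: "(complex \<Rightarrow> complex) \<Rightarrow> complex \<Rightarrow> complex" where
  "theta y = (\<lambda>z. z * deriv y z)"

definition apply_op :: "diffop \<Rightarrow> (complex \<Rightarrow> complex) \<Rightarrow> complex \<Rightarrow> complex" where
  "apply_op P y z = (\<Sum>i\<le>degree P. rf_eval (coeff P i) z * (theta ^^ i) y z)"

text \<open>
  The operator \<open>P(\<Theta> - \<alpha>, t)\<close>. Powers of \<open>\<Theta> - \<alpha>\<close> expand as in a commutative ring and the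
  coefficients stay on the left, so the formal substitution of polynomials is the right one.
\<close>

definition shift :: "complex \<Rightarrow> diffop \<Rightarrow> diffop" where
  "shift \<alpha> P = pcompose P [:rf_const (- \<alpha>), 1:]"

text \<open>
  With \<open>D = d/dt\<close> one has \<open>\<Theta>\<^sup>k = (\<Sum>j\<le>k. Stirling k j * t\<^sup>j D\<^sup>j)\<close>. For \<open>P\<close> monic of degree \<open>n\<close> in
  \<open>\<Theta>\<close>, the operator \<open>t\<^sup>-\<^sup>n P\<close> is therefore \<open>D\<^sup>n + q\<^sub>n\<^sub>-\<^sub>1(t) D\<^sup>n\<^sup>-\<^sup>1 + \<dots> + q\<^sub>0(t)\<close> with the
  following coefficients \<open>q\<^sub>j\<close>.
\<close>

definition d_coeff :: "diffop \<Rightarrow> nat \<Rightarrow> ratfun" where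
  "d_coeff P j =
     (\<Sum>k\<le>degree P. of_nat (Stirling k j) * coeff P k) / rf_t ^ (degree P - j)"

definition singular_point :: "diffop \<Rightarrow> complex \<Rightarrow> bool" where
  "singular_point P a \<longleftrightarrow> (\<exists>j<degree P. rf_pole_order a (d_coeff P j) > 0)"

definition regular_singular_point :: "diffop \<Rightarrow> complex \<Rightarrow> bool" where
  "regular_singular_point P a \<longleftrightarrow> singular_point P a \<and>
     (\<forall>j<degree P. rf_pole_order a (d_coeff P j) \<le> degree P - j)"

text \<open>
  The operator in the coordinate \<open>w = 1/t\<close>, made monic again. Since \<open>t d/dt = - w d/dw\<close>,
  it is \<open>(\<Sum>i\<le>n. (-1)\<^sup>n\<^sup>-\<^sup>i p\<^sub>i(1/w) (w d/dw)\<^sup>i)\<close>.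
\<close>

definition at_infinity_op :: "diffop \<Rightarrow> diffop" where
  "at_infinity_op P =
     (\<Sum>i\<le>degree P. monom ((- 1) ^ (degree P - i) * rf_reciprocal_arg (coeff P i)) i)"

definition fuchsian :: "diffop \<Rightarrow> bool" where
  "fuchsian P \<longleftrightarrow>
     (\<forall>a. singular_point P a \<longrightarrow> regular_singular_point P a) \<and>
     (singular_point (at_infinity_op P) 0 \<longrightarrow> regular_singular_point (at_infinity_op P) 0)"


section \<open>Monodromy\<close>

text \<open>
  The Riemann sphere minus \<open>0\<close>, \<open>\<infinity>\<close> and the singular points of \<open>P\<close>.
\<close>

definition regular_locus :: "diffop \<Rightarrow> complex set" where
  "regular_locus P = - insert 0 {a. singular_point P a}"

text \<open>
  Germs at \<open>b\<close> are represented by functions on \<open>\<complex>\<close>, compared by eventual equality in \<open>nhds b\<close>.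
\<close>

definition local_solution :: "diffop \<Rightarrow> complex \<Rightarrow> (complex \<Rightarrow> complex) \<Rightarrow> bool" where
  "local_solution P b y \<longleftrightarrow> y analytic_on {b} \<and> (\<forall>\<^sub>F z in nhds b. apply_op P y z = 0)"

definition solution_basis :: "diffop \<Rightarrow> complex \<Rightarrow> (4 \<Rightarrow> complex \<Rightarrow> complex) \<Rightarrow> bool" where
  "solution_basis P b f \<longleftrightarrow>
     (\<forall>i. local_solution P b (f i)) \<and>
     (\<forall>y. local_solution P b y \<longrightarrow>
        (\<exists>!c::complex^4. \<forall>\<^sub>F z in nhds b. y z = (\<Sum>i\<in>UNIV. c $ i * f i z)))"

text \<open>
  The germ of \<open>g\<close> at the end of the path \<open>\<gamma>\<close> is the analytic continuation along \<open>\<gamma>\<close> of the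
  germ of \<open>f\<close> at its start; \<open>F s\<close> is the germ reached at time \<open>s\<close>.
\<close>

definition continues_along ::
    "(real \<Rightarrow> complex) \<Rightarrow> (complex \<Rightarrow> complex) \<Rightarrow> (complex \<Rightarrow> complex) \<Rightarrow> bool" where
  "continues_along \<gamma> f g \<longleftrightarrow>
     (\<exists>F :: real \<Rightarrow> complex \<Rightarrow> complex.
        (\<forall>s\<in>{0..1}. F s analytic_on {\<gamma> s}) \<and>
        (\<forall>s\<in>{0..1}. \<forall>\<^sub>F s' in at s within {0..1}. \<forall>\<^sub>F z in nhds (\<gamma> s'). F s' z = F s z) \<and>
        (\<forall>\<^sub>F z in nhds (pathstart \<gamma>). F 0 z = f z) \<and>
        (\<forall>\<^sub>F z in nhds (pathfinish \<gamma>). F 1 z = g z))"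

text \<open>
  The monodromy group with base point \<open>b\<close>, written as a group of matrices in the basis \<open>f\<close> of the
  space of solutions near \<open>b\<close>: column \<open>j\<close> holds the coordinates of the continuation of \<open>f j\<close>.
\<close>

definition monodromy_group ::
    "diffop \<Rightarrow> complex \<Rightarrow> (4 \<Rightarrow> complex \<Rightarrow> complex) \<Rightarrow> (complex^4^4) set" where
  "monodromy_group P b f =
     {M. \<exists>\<gamma>. path \<gamma> \<and> path_image \<gamma> \<subseteq> regular_locus P \<and> pathstart \<gamma> = b \<and> pathfinish \<gamma> = b \<and>
           (\<forall>j. continues_along \<gamma> (f j) (\<lambda>z. \<Sum>i\<in>UNIV. M $ i $ j * f i z))}"


section \<open>Symplectic groups and Zariski density\<close>

definition sympl_form :: "complex^4^4" where
  "sympl_form = vector [vector [ 0, 1,  0, 0],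
                        vector [-1, 0,  0, 0],
                        vector [ 0, 0,  0, 1],
                        vector [ 0, 0, -1, 0]]"

definition Sp4C :: "(complex^4^4) set" where
  "Sp4C = {A. transpose A ** sympl_form ** A = sympl_form}"

definition Sp4Z :: "(complex^4^4) monoid" where
  "Sp4Z = \<lparr>carrier = {A \<in> Sp4C. \<forall>i j. A $ i $ j \<in> \<int>}, mult = (**), one = mat 1\<rparr>"

inductive polynomial_fun :: "(complex^4^4 \<Rightarrow> complex) \<Rightarrow> bool" where
  const: "polynomial_fun (\<lambda>A. c)"
| entry: "polynomial_fun (\<lambda>A. A $ i $ j)"
| add: "polynomial_fun p \<Longrightarrow> polynomial_fun q \<Longrightarrow> polynomial_fun (\<lambda>A. p A + q A)"
| mult: "polynomial_fun p \<Longrightarrow> polynomial_fun q \<Longrightarrow> polynomial_fun (\<lambda>A. p A * q A)"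

definition zariski_closure :: "(complex^4^4) set \<Rightarrow> (complex^4^4) set" where
  "zariski_closure X = {A. \<forall>p. polynomial_fun p \<longrightarrow> (\<forall>B\<in>X. p B = 0) \<longrightarrow> p A = 0}"

definition conj_by :: "complex^4^4 \<Rightarrow> (complex^4^4) set \<Rightarrow> (complex^4^4) set" where
  "conj_by C G = (\<lambda>A. C ** A ** matrix_inv C) ` G"

text \<open>
  \<open>C\<close> conjugates \<open>G\<close> to a Zariski-dense subgroup of \<open>Sp(4,\<int>)\<close>; density is meant in \<open>Sp(4,\<complex>)\<close>.
\<close>

definition sympl_identification :: "complex^4^4 \<Rightarrow> (complex^4^4) set \<Rightarrow> bool" where
  "sympl_identification C G \<longleftrightarrow>
     invertible C \<and> subgroup (conj_by C G) Sp4Z \<and> Sp4C \<subseteq> zariski_closure (conj_by C G)"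

text \<open>
  Monodromy groups for different base points and bases are conjugate, so the two properties below
  do not depend on these choices: every base point is required to admit a basis of
  solutions and an identification. Whether the index is finite does not depend on the
  identification either.
\<close>

definition symplectic :: "diffop \<Rightarrow> bool" where
  "symplectic P \<longleftrightarrow> order4_operator P \<and> fuchsian P \<and>
     (\<forall>b\<in>regular_locus P. \<exists>f C. solution_basis P b f \<and>
        sympl_identification C (monodromy_group P b f))"

definition arithmetic :: "diffop \<Rightarrow> bool" where
  "arithmetic P \<longleftrightarrow>
     (\<forall>b\<in>regular_locus P. \<exists>f C. solution_basis P b f \<and>
        sympl_identification C (monodromy_group P b f) \<and>
        finite (rcosets\<^bsub>Sp4Z\<^esub> (conj_by C (monodromy_group P b f))))"

end

theory Submission
  imports Defs
begin

unbundle no fps_syntax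

text \<open>
  If \<open>P y = 0\<close> then \<open>P(\<alpha>)\<close> annihilates \<open>t\<^sup>\<alpha> y\<close>, so continuation along a loop \<open>\<gamma>\<close> with winding
  number \<open>n\<close> around \<open>0\<close> has matrix \<open>\<mu>\<^sup>n M\<close> for \<open>P(\<alpha>)\<close> when it has matrix \<open>M\<close> for \<open>P\<close>, where
  \<open>\<mu> = e\<^bsup>2\<pi>\<i>\<alpha>\<^esup>\<close>. If \<open>2\<alpha>\<close> is an integer the two groups agree up to signs. This preserves finiteness
  of the index, and it preserves density because \<open>A\<close> and \<open>- A\<close> are joined by a holomorphic curve in
  \<open>Sp(4,\<complex>)\<close>.

  Conversely, take a loop around \<open>0\<close> with winding number one and matrix \<open>N\<close>. For \<open>M\<close> in the monodromy
  group of \<open>P\<close>, the numbers \<open>tr M\<close>, \<open>\<mu>\<^sup>n tr M\<close>, \<open>tr (M N)\<close>, \<open>\<mu>\<^bsup>n+1\<^esup> tr (M N)\<close> are all integers.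
  If \<open>\<mu>\<close> is not real, then \<open>tr M * tr (M N) = 0\<close>; by density this holds on all of \<open>Sp(4,\<complex>)\<close>, which
  is absurd. So \<open>\<mu>\<close> is real, and comparing determinants gives \<open>\<mu>\<^sup>8 = 1\<close>, hence \<open>\<mu> = \<plusminus>1\<close>.
\<close>

section \<open>Rational functions and their poles\<close>

text \<open>That the shift stays Fuchsian needs an argument, because the Fuchs conditions are
  imposed on the coefficients of powers of \<open>d/dt\<close> and, at infinity, in another
  coordinate. Written in powers of \<Theta> they bound the coefficients p_i: a pole of order at most
  n - i away from 0, no pole at 0 or at infinity. No bound gets stricter as i decreases, and
  replacing \<Theta> by \<Theta> - \<alpha> moves p_i only to lower powers.

  In the converse, the identifications of the two groups with subgroups of Sp(4,Z) come from
  unrelated bases and conjugating matrices, so entries cannot be compared; traces and determinants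
  can. The exponent n belongs to an unknown loop for M. The second trace is there to eliminate it:
  the ratio of the two factors is \<mu> itself. Determinants alone would leave all eighth roots of
  unity, traces alone any real \<mu>.

  A loop has a matrix only if solutions continue along it. For the loop around 0 this is derived
  from the solution bases that the hypothesis on P supplies at every regular point.\<close>

definition pole_le :: "nat \<Rightarrow> complex \<Rightarrow> ratfun \<Rightarrow> bool" where
  "pole_le k a r \<longleftrightarrow> (\<exists>p q. poly q a \<noteq> 0 \<and> r = Fract p ([:- a, 1:] ^ k * q))"

lemma rf_den_nonzero [simp]: "rf_den r \<noteq> 0"
  by (simp add: rf_den_def)

lemma Fract_num_den: "Fract (rf_num r) (rf_den r) = r"
  by (simp add: rf_num_def rf_den_def)

lemma coprime_num_den: "coprime (rf_num r) (rf_den r)"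
  by (simp add: rf_num_def rf_den_def coprime_quot_of_fract)

lemma rf_den_dvd:
  assumes "r = Fract p q" "q \<noteq> 0"
  shows "rf_den r dvd q"
proof -
  have "Fract (rf_num r) (rf_den r) = Fract p q"
    using assms Fract_num_den by simp
  then have "rf_num r * q = p * rf_den r"
    using assms by (simp add: eq_fract)
  then have "rf_den r dvd rf_num r * q"
    by simp
  then show ?thesis
    using coprime_num_den coprime_commute coprime_dvd_mult_right_iff by metis
qed

lemma linear_power_mult_nonzero:
  fixes q :: "complex poly"
  assumes "poly q a \<noteq> 0"
  shows "[:- a, 1:] ^ k * q \<noteq> 0"
proof -
  have "q \<noteq> 0" using assms by auto
  then show ?thesis by simp
qed

text \<open>The representation in \<open>pole_le\<close> need not be reduced, which makes sums and
  products easy. The reduced denominator divides every other one, so its order at \<open>a\<close>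
  is the least possible \<open>k\<close>; conversely, extra linear factors pad it up to any larger
  \<open>k\<close>.\<close>

lemma pole_le_iff: "pole_le k a r \<longleftrightarrow> rf_pole_order a r \<le> k"
proof
  assume "pole_le k a r"
  then obtain p q where q: "poly q a \<noteq> 0" and r: "r = Fract p ([:- a, 1:] ^ k * q)"
    unfolding pole_le_def by blast
  have nz: "[:- a, 1:] ^ k * q \<noteq> 0"
    using linear_power_mult_nonzero[OF q] .
  have "rf_pole_order a r \<le> Polynomial.order a ([:- a, 1:] ^ k * q)"
    unfolding rf_pole_order_def using rf_den_dvd[OF r nz] nz dvd_imp_order_le by blast
  also have "\<dots> = k"
    using nz q by (simp add: order_mult order_power_n_n order_0I)
  finally show "rf_pole_order a r \<le> k" .
next
  assume le: "rf_pole_order a r \<le> k"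
  define m where "m = Polynomial.order a (rf_den r)"
  obtain q where q: "rf_den r = [:- a, 1:] ^ m * q" "\<not> [:- a, 1:] dvd q"
    using order_decomp[of "rf_den r" a] unfolding m_def by auto
  have "r = Fract (rf_num r) (rf_den r)" by (simp add: Fract_num_den)
  also have "\<dots> = Fract ([:- a, 1:] ^ (k - m) * rf_num r) ([:- a, 1:] ^ (k - m) * rf_den r)"
    by (rule mult_fract_cancel[symmetric]) simp
  also have "[:- a, 1:] ^ (k - m) * rf_den r = [:- a, 1:] ^ (k - m + m) * q"
    by (simp only: q(1) power_add mult.assoc)
  also have "k - m + m = k"
    using le by (simp add: m_def rf_pole_order_def)
  finally show "pole_le k a r"
    unfolding pole_le_def using q(2) poly_eq_0_iff_dvd by blast
qed

lemma pole_le_add: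
  assumes "pole_le k a r" "pole_le k a s"
  shows "pole_le k a (r + s)"
proof -
  obtain p q where q: "poly q a \<noteq> 0" and r: "r = Fract p ([:- a, 1:] ^ k * q)"
    using assms unfolding pole_le_def by auto
  obtain p' q' where q': "poly q' a \<noteq> 0" and s: "s = Fract p' ([:- a, 1:] ^ k * q')"
    using assms unfolding pole_le_def by auto
  let ?l = "[:- a, 1:] ^ k"
  have nz: "?l * q \<noteq> 0" "?l * q' \<noteq> 0"
    using q q' linear_power_mult_nonzero by auto
  have "r + s = Fract (p * (?l * q') + p' * (?l * q)) ((?l * q) * (?l * q'))"
    using r s nz by simp
  also have "\<dots> = Fract (?l * (p * q' + p' * q)) (?l * (?l * (q * q')))"
    by (simp add: algebra_simps)
  also have "\<dots> = Fract (p * q' + p' * q) (?l * (q * q'))"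
    by (rule mult_fract_cancel) simp
  finally have "r + s = Fract (p * q' + p' * q) (?l * (q * q'))" .
  moreover have "poly (q * q') a \<noteq> 0"
    using q q' by simp
  ultimately show ?thesis
    unfolding pole_le_def by blast
qed

lemma pole_le_mult:
  assumes "pole_le k a r" "pole_le l a s"
  shows "pole_le (k + l) a (r * s)"
proof -
  obtain p q where q: "poly q a \<noteq> 0" and r: "r = Fract p ([:- a, 1:] ^ k * q)"
    using assms unfolding pole_le_def by auto
  obtain p' q' where q': "poly q' a \<noteq> 0" and s: "s = Fract p' ([:- a, 1:] ^ l * q')"
    using assms unfolding pole_le_def by auto
  have "r * s = Fract (p * p') ([:- a, 1:] ^ (k + l) * (q * q'))"
    unfolding r s by (simp add: power_add algebra_simps)
  moreover have "poly (q * q') a \<noteq> 0"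
    using q q' by simp
  ultimately show ?thesis
    unfolding pole_le_def by blast
qed

lemma pole_le_mono: "pole_le k a r \<Longrightarrow> k \<le> l \<Longrightarrow> pole_le l a r"
  by (simp add: pole_le_iff)

lemma pole_le_Fract: "poly q a \<noteq> 0 \<Longrightarrow> pole_le 0 a (Fract p q)"
  unfolding pole_le_def by (intro exI[of _ p] exI[of _ q]) simp

lemma pole_le_of_poly [simp]: "pole_le k a (rf_of_poly p)"
  by (rule pole_le_mono[of 0]) (simp_all add: rf_of_poly_def pole_le_Fract)

lemma rf_of_poly_0: "rf_of_poly 0 = 0" and rf_of_poly_1: "rf_of_poly 1 = 1"
  unfolding rf_of_poly_def by (simp_all only: fract_collapse)

lemma rf_of_poly_add: "rf_of_poly (p + q) = rf_of_poly p + rf_of_poly q"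
  and rf_of_poly_mult: "rf_of_poly (p * q) = rf_of_poly p * rf_of_poly q"
  and rf_of_poly_minus: "rf_of_poly (- p) = - rf_of_poly p"
  unfolding rf_of_poly_def by simp_all

lemmas rf_of_poly_hom = rf_of_poly_0 rf_of_poly_1 rf_of_poly_add rf_of_poly_mult rf_of_poly_minus

lemma rf_of_poly_power: "rf_of_poly (p ^ n) = rf_of_poly p ^ n"
  by (induction n) (simp_all add: rf_of_poly_hom)

lemma rf_of_nat: "of_nat n = rf_const (of_nat n)"
proof (induction n)
  case (Suc n)
  have "[:1 + of_nat n:] = 1 + [:of_nat n :: complex:]"
    by (simp add: one_pCons)
  then show ?case using Suc by (simp only: of_nat_Suc rf_of_poly_hom)
qed (simp add: rf_of_poly_hom)

lemma rf_const_power: "rf_const c ^ n = rf_const (c ^ n)"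
  by (simp add: rf_of_poly_power[symmetric] poly_const_pow)

lemma pole_le_simps [simp]: "pole_le k a 0" "pole_le k a 1" "pole_le k a (of_nat n)"
  "pole_le k a (rf_const c ^ n)"
  using pole_le_of_poly[of k a 0] pole_le_of_poly[of k a 1]
  by (simp_all add: rf_of_poly_hom rf_of_nat rf_const_power)

lemma rf_const_1 [simp]: "rf_const 1 = 1"
  using rf_of_poly_1 by (simp add: one_pCons)

lemma pole_le_mult_const:
  "pole_le 0 a c \<Longrightarrow> pole_le k a r \<Longrightarrow> pole_le k a (c * r)"
  using pole_le_mult[of 0 a c k r] by simp

lemma pole_le_sum: "(\<And>i. i \<in> I \<Longrightarrow> pole_le k a (f i)) \<Longrightarrow> pole_le k a (sum f I)"
  by (induction I rule: infinite_finite_induct) (simp_all add: pole_le_add)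

lemma pole_le_uminus [simp]: "pole_le k a (- r) \<longleftrightarrow> pole_le k a r"
proof -
  have "pole_le k a (- s)" if "pole_le k a s" for s
    using that pole_le_mult_const[of a "rf_of_poly (- 1)" k s] pole_le_of_poly[of 0 a "- 1"]
    by (simp only: rf_of_poly_minus rf_of_poly_1 mult_minus1)
  from this[of r] this[of "- r"] show ?thesis by auto
qed

lemma rf_t_nonzero [simp]: "rf_t \<noteq> 0"
  by (simp add: rf_of_poly_def Zero_fract_def eq_fract)

lemma inverse_rf_of_poly: "inverse (rf_of_poly p) = Fract 1 p"
  by (simp add: rf_of_poly_def)

text \<open>Away from 0 the function \<open>t\<close> is a unit, so dividing by its powers changes
  no pole order.\<close>

lemma pole_le_divide_t:
  assumes "a \<noteq> 0"
  shows "pole_le k a (r / rf_t ^ n) \<longleftrightarrow> pole_le k a r"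
proof
  assume "pole_le k a (r / rf_t ^ n)"
  then have "pole_le k a (rf_t ^ n * (r / rf_t ^ n))"
    by (intro pole_le_mult_const) (simp_all flip: rf_of_poly_power)
  then show "pole_le k a r" by simp
next
  assume "pole_le k a r"
  moreover have "pole_le 0 a (inverse (rf_t ^ n))"
    unfolding rf_of_poly_power[symmetric] inverse_rf_of_poly
    using assms by (intro pole_le_Fract) (simp add: poly_power)
  ultimately show "pole_le k a (r / rf_t ^ n)"
    using pole_le_mult_const[of a "inverse (rf_t ^ n)" k r] by (simp add: field_simps)
qed

text \<open>At 0 each factor \<open>t\<close> in the denominator costs exactly one order. This turns
  the Fuchs bound at 0 into plain regularity of the \<Theta>-coefficients.\<close>

lemma pole_le_divide_t_0:
  "pole_le n 0 (r / rf_t ^ n) \<longleftrightarrow> pole_le 0 0 r"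
proof
  assume "pole_le n 0 (r / rf_t ^ n)"
  then obtain p q where q: "poly q 0 \<noteq> 0" and r: "r / rf_t ^ n = Fract p ([:- 0, 1:] ^ n * q)"
    unfolding pole_le_def by auto
  have "r = rf_t ^ n * (r / rf_t ^ n)"
    by simp
  also have "\<dots> = Fract ([:0,1:] ^ n) 1 * Fract p ([:0, 1:] ^ n * q)"
    unfolding r unfolding rf_of_poly_power[symmetric] unfolding rf_of_poly_def by (simp only: minus_zero)
  also have "\<dots> = Fract ([:0, 1:] ^ n * p) ([:0, 1:] ^ n * q)"
    by (simp only: mult_fract mult_1)
  also have "\<dots> = Fract p q"
    by (rule mult_fract_cancel) simp
  finally show "pole_le 0 0 r" using q pole_le_Fract by blast
next
  assume "pole_le 0 0 r"
  moreover have "pole_le n 0 (inverse (rf_t ^ n))"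
    unfolding pole_le_def rf_of_poly_power[symmetric] inverse_rf_of_poly
    by (rule exI[of _ 1], rule exI[of _ 1]) simp
  ultimately show "pole_le n 0 (r / rf_t ^ n)"
    using pole_le_mult[of n 0 "inverse (rf_t ^ n)" 0 r] by (simp add: field_simps)
qed

section \<open>Evaluation of rational functions at regular points\<close>

lemma rf_eval_Fract:
  assumes "poly q a \<noteq> 0"
  shows "rf_eval (Fract p q) a = poly p a / poly q a"
proof -
  let ?r = "Fract p q"
  have nz: "q \<noteq> 0" using assms by auto
  have "Fract (rf_num ?r) (rf_den ?r) = Fract p q"
    by (simp add: Fract_num_den)
  then have "rf_num ?r * q = p * rf_den ?r"
    using nz by (simp add: eq_fract)
  then have "poly (rf_num ?r) a * poly q a = poly p a * poly (rf_den ?r) a"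
    by (metis poly_mult)
  moreover have "poly (rf_den ?r) a \<noteq> 0"
    using rf_den_dvd[OF refl nz] assms by (metis dvdE mult_eq_0_iff poly_mult)
  ultimately show ?thesis
    using assms by (simp add: rf_eval_def field_simps)
qed

lemma regular_obtain_Fract:
  assumes "pole_le 0 a r"
  obtains p q where "r = Fract p q" "poly q a \<noteq> 0"
proof -
  obtain p q where "poly q a \<noteq> 0" "r = Fract p ([:- a, 1:] ^ 0 * q)"
    using assms unfolding pole_le_def by blast
  then show thesis using that[of p q] by simp
qed

lemma rf_eval_add:
  assumes "pole_le 0 a r" "pole_le 0 a s"
  shows "rf_eval (r + s) a = rf_eval r a + rf_eval s a"
proof -
  obtain p q where 1: "r = Fract p q" "poly q a \<noteq> 0"
    using assms regular_obtain_Fract by metis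
  obtain p' q' where 2: "s = Fract p' q'" "poly q' a \<noteq> 0"
    using assms regular_obtain_Fract by metis
  have "q \<noteq> 0" "q' \<noteq> 0" using 1 2 by auto
  then have "r + s = Fract (p * q' + p' * q) (q * q')"
    using 1(1) 2(1) by simp
  also have "rf_eval \<dots> a = poly (p * q' + p' * q) a / poly (q * q') a"
    using 1(2) 2(2) by (intro rf_eval_Fract) simp
  also have "\<dots> = poly p a / poly q a + poly p' a / poly q' a"
    using 1(2) 2(2) by (simp add: add_frac_eq)
  finally show ?thesis
    unfolding 1(1) 2(1) rf_eval_Fract[OF 1(2)] rf_eval_Fract[OF 2(2)] .
qed

lemma rf_eval_mult:
  assumes "pole_le 0 a r" "pole_le 0 a s"
  shows "rf_eval (r * s) a = rf_eval r a * rf_eval s a"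
proof -
  obtain p q where 1: "r = Fract p q" "poly q a \<noteq> 0"
    using assms regular_obtain_Fract by metis
  obtain p' q' where 2: "s = Fract p' q'" "poly q' a \<noteq> 0"
    using assms regular_obtain_Fract by metis
  have "r * s = Fract (p * p') (q * q')"
    using 1(1) 2(1) by simp
  also have "rf_eval \<dots> a = poly (p * p') a / poly (q * q') a"
    using 1(2) 2(2) by (intro rf_eval_Fract) simp
  finally show ?thesis
    unfolding 1(1) 2(1) rf_eval_Fract[OF 1(2)] rf_eval_Fract[OF 2(2)] by simp
qed

lemma rf_eval_of_poly [simp]: "rf_eval (rf_of_poly p) a = poly p a"
  by (simp add: rf_of_poly_def rf_eval_Fract)

lemma rf_eval_0 [simp]: "rf_eval 0 a = 0"
  using rf_eval_of_poly[of 0 a] by (simp add: rf_of_poly_hom)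

section \<open>Rational functions without a pole at infinity\<close>

definition pole_free_at_infinity :: "ratfun \<Rightarrow> bool" where
  "pole_free_at_infinity r \<longleftrightarrow> (\<exists>p q. q \<noteq> 0 \<and> degree p \<le> degree q \<and> r = Fract p q)"

lemma pole_free_at_infinity_add:
  assumes "pole_free_at_infinity r" "pole_free_at_infinity s"
  shows "pole_free_at_infinity (r + s)"
proof -
  obtain p q where 1: "q \<noteq> 0" "degree p \<le> degree q" "r = Fract p q"
    using assms unfolding pole_free_at_infinity_def by blast
  obtain p' q' where 2: "q' \<noteq> 0" "degree p' \<le> degree q'" "s = Fract p' q'"
    using assms unfolding pole_free_at_infinity_def by blast
  have "degree (p * q') \<le> degree (q * q')" "degree (p' * q) \<le> degree (q * q')"
    using 1 2 by (auto intro!: order_trans[OF degree_mult_le] simp: degree_mult_eq)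
  then have "degree (p * q' + p' * q) \<le> degree (q * q')"
    by (rule degree_add_le)
  then show ?thesis
    unfolding pole_free_at_infinity_def
    using 1 2 by (intro exI[of _ "p * q' + p' * q"] exI[of _ "q * q'"]) auto
qed

lemma pole_free_at_infinity_const [simp]: "pole_free_at_infinity (rf_const c)"
  unfolding pole_free_at_infinity_def rf_of_poly_def
  by (intro exI[of _ "[:c:]"] exI[of _ 1]) auto

lemma pole_free_at_infinity_mult:
  assumes "pole_free_at_infinity r" "pole_free_at_infinity s"
  shows "pole_free_at_infinity (r * s)"
proof -
  obtain p q where 1: "q \<noteq> 0" "degree p \<le> degree q" "r = Fract p q"
    using assms unfolding pole_free_at_infinity_def by blast
  obtain p' q' where 2: "q' \<noteq> 0" "degree p' \<le> degree q'" "s = Fract p' q'"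
    using assms unfolding pole_free_at_infinity_def by blast
  have "degree (p * p') \<le> degree (q * q')"
    using 1 2 by (auto intro!: order_trans[OF degree_mult_le] simp: degree_mult_eq)
  then show ?thesis
    unfolding pole_free_at_infinity_def
    using 1 2 by (intro exI[of _ "p * p'"] exI[of _ "q * q'"]) auto
qed

lemma rf_reciprocal_arg_eq:
  "rf_reciprocal_arg r =
    Fract (reflect_poly (rf_num r) * [:0,1:] ^ degree (rf_den r))
          (reflect_poly (rf_den r) * [:0,1:] ^ degree (rf_num r))"
  unfolding rf_reciprocal_arg_def rf_of_poly_power[symmetric]
  unfolding rf_of_poly_def by (simp only: divide_fract mult_fract mult_1 mult_1_right mult.commute)

lemma poly_reflect_poly_0_nonzero: "p \<noteq> 0 \<Longrightarrow> poly (reflect_poly p) 0 \<noteq> 0"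
  by (simp add: poly_0_coeff_0)

text \<open>The reflection of a nonzero polynomial does not vanish at 0, so only the powers of
  \<open>t\<close> count there, and their exponents are the two degrees. Comparing degrees is the
  form that passes easily to sums and products.\<close>

lemma pole_free_at_infinity_iff: "pole_free_at_infinity r \<longleftrightarrow> pole_le 0 0 (rf_reciprocal_arg r)"
proof -
  let ?n = "rf_num r" and ?d = "rf_den r"
  have 1: "pole_free_at_infinity r \<longleftrightarrow> degree ?n \<le> degree ?d"
  proof
    assume "pole_free_at_infinity r"
    then obtain p q where q: "q \<noteq> 0" "degree p \<le> degree q" "r = Fract p q"
      unfolding pole_free_at_infinity_def by blast
    then have "Fract ?n ?d = Fract p q"
      using Fract_num_den by simp
    then have eq: "?n * q = p * ?d"
      using q by (simp add: eq_fract)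
    show "degree ?n \<le> degree ?d"
    proof (cases "?n = 0")
      case False
      then have "p \<noteq> 0" using eq q by auto
      then have "degree ?n + degree q = degree p + degree ?d"
        using arg_cong[OF eq, of degree] False q by (simp add: degree_mult_eq)
      then show ?thesis using q by simp
    qed simp
  next
    assume "degree ?n \<le> degree ?d"
    then show "pole_free_at_infinity r"
      unfolding pole_free_at_infinity_def using Fract_num_den
      by (intro exI[of _ ?n] exI[of _ ?d]) simp
  qed
  have t: "[:0, 1 :: complex:] ^ k \<noteq> 0" for k by simp
  have 2: "degree ?n \<le> degree ?d \<longleftrightarrow> pole_le 0 0 (rf_reciprocal_arg r)"
  proof
    assume le: "degree ?n \<le> degree ?d"
    have "rf_reciprocal_arg r =
       Fract ([:0,1:] ^ degree ?n * (reflect_poly ?n * [:0,1:] ^ (degree ?d - degree ?n)))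
             ([:0,1:] ^ degree ?n * reflect_poly ?d)"
      unfolding rf_reciprocal_arg_eq mult.left_commute[of "_ ^ _" "reflect_poly _" "_ ^ _"]
        power_add[symmetric] using le by (simp add: mult.commute)
    also have "\<dots> = Fract (reflect_poly ?n * [:0,1:] ^ (degree ?d - degree ?n)) (reflect_poly ?d)"
      by (rule mult_fract_cancel) (rule t)
    finally show "pole_le 0 0 (rf_reciprocal_arg r)"
      by (simp add: pole_le_Fract poly_reflect_poly_0_nonzero)
  next
    assume ass: "pole_le 0 0 (rf_reciprocal_arg r)"
    show "degree ?n \<le> degree ?d"
    proof (rule ccontr)
      assume gt: "\<not> degree ?n \<le> degree ?d"
      obtain p q where pq: "rf_reciprocal_arg r = Fract p q" "poly q 0 \<noteq> 0"
        using ass regular_obtain_Fract by metis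
      have "rf_reciprocal_arg r =
         Fract ([:0,1:] ^ degree ?d * reflect_poly ?n)
               ([:0,1:] ^ degree ?d * (reflect_poly ?d * [:0,1:] ^ (degree ?n - degree ?d)))"
        unfolding rf_reciprocal_arg_eq mult.left_commute[of "_ ^ _" "reflect_poly _" "_ ^ _"]
          power_add[symmetric] using gt by (simp add: mult.commute)
      also have "\<dots> = Fract (reflect_poly ?n) (reflect_poly ?d * [:0,1:] ^ (degree ?n - degree ?d))"
        by (rule mult_fract_cancel) (rule t)
      finally have "Fract p q = Fract (reflect_poly ?n) (reflect_poly ?d * [:0,1:] ^ (degree ?n - degree ?d))"
        using pq by simp
      moreover have "q \<noteq> 0" using pq by auto
      ultimately have "p * (reflect_poly ?d * [:0,1:] ^ (degree ?n - degree ?d)) = reflect_poly ?n * q"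
        by (subst (asm) eq_fract) auto
      \<comment> \<open>A positive power of \<open>t\<close> remains on the left because the
        numerator has the larger degree; evaluating at 0 kills that side but not the other.\<close>
      from arg_cong[OF this, of "\<lambda>p. poly p 0"] gt
      have "poly (reflect_poly ?n) 0 * poly q 0 = 0"
        by (simp add: poly_power zero_power)
      then show False using pq gt poly_reflect_poly_0_nonzero[of ?n] by auto
    qed
  qed
  show ?thesis using 1 2 by simp
qed

section \<open>The Fuchs conditions and the shift\<close>

lemma degree_shift [simp]: "degree (shift \<alpha> P) = degree P"
  unfolding shift_def by (simp add: degree_pcompose)

lemma order4_operator_shift:
  assumes "order4_operator P"
  shows "order4_operator (shift \<alpha> P)"
proof -
  have "lead_coeff (shift \<alpha> P) = lead_coeff P"
    unfolding shift_def by (subst lead_coeff_comp) simp_all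
  then show ?thesis using assms by (metis degree_shift order4_operator_def)
qed

lemma shift_shift: "shift \<beta> (shift \<alpha> P) = shift (\<alpha> + \<beta>) P"
proof -
  have "rf_const (- \<alpha>) + rf_const (- \<beta>) = rf_const (- (\<alpha> + \<beta>))"
    by (simp flip: rf_of_poly_add)
  then have "pcompose [:rf_const (- \<alpha>), 1:] [:rf_const (- \<beta>), 1:] = [:rf_const (- (\<alpha> + \<beta>)), 1:]"
    by (simp add: pcompose_pCons add.commute)
  then show ?thesis
    unfolding shift_def by (simp flip: pcompose_assoc)
qed

lemma shift_0 [simp]: "shift 0 P = P"
  by (simp add: shift_def rf_of_poly_0)

lemma shift_uminus_shift [simp]: "shift (- \<alpha>) (shift \<alpha> P) = P"
  by (simp add: shift_shift)

section \<open>Coefficient conditions preserved by the shift\<close>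

locale coeff_filtration =
  fixes V :: "nat \<Rightarrow> ratfun set"
  assumes zero_mem: "0 \<in> V j"
    and add_mem: "r \<in> V j \<Longrightarrow> s \<in> V j \<Longrightarrow> r + s \<in> V j"
    and const_mem: "r \<in> V j \<Longrightarrow> rf_const c * r \<in> V j"
    and decreasing: "i \<le> j \<Longrightarrow> V j \<subseteq> V i"
begin

lemma sum_mem: "(\<And>i. i \<in> I \<Longrightarrow> f i \<in> V j) \<Longrightarrow> sum f I \<in> V j"
  by (induction I rule: infinite_finite_induct) (auto intro: zero_mem add_mem)

text \<open>Expanding \<open>(\<Theta> + c)^i\<close> moves the coefficient of index
  \<open>i\<close> only to indices at most \<open>i\<close>, where \<open>V\<close> is at least as
  large. The offset \<open>m\<close> absorbs the change of index in the \<open>pCons\<close>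
  induction.\<close>

lemma pcompose_linear_mem:
  assumes "\<And>i. coeff P i \<in> V (m + i)"
  shows "coeff (pcompose P [:rf_const c, 1:]) j \<in> V (m + j)"
  using assms
proof (induction P arbitrary: j m)
  case 0
  then show ?case by (simp add: zero_mem)
next
  case (pCons a P)
  let ?R = "pcompose P [:rf_const c, 1:]"
  have "coeff P i \<in> V (Suc m + i)" for i
    using pCons.prems[of "Suc i"] by simp
  then have R: "coeff ?R i \<in> V (Suc m + i)" for i
    using pCons.IH by blast
  have R': "coeff ?R i \<in> V (m + i)" for i
    using R[of i] decreasing[of "m + i" "Suc m + i"] by auto
  have a: "a \<in> V m" using pCons.prems[of 0] by simp
  show ?case
  proof (cases j)
    case 0
    have "coeff (pcompose (pCons a P) [:rf_const c, 1:]) 0 = a + rf_const c * coeff ?R 0"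
      by (simp add: pcompose_pCons)
    then show ?thesis
      using 0 a R'[of 0] by (simp add: add_mem const_mem)
  next
    case (Suc k)
    have "coeff (pcompose (pCons a P) [:rf_const c, 1:]) (Suc k) = rf_const c * coeff ?R (Suc k) + coeff ?R k"
      by (simp add: pcompose_pCons)
    then show ?thesis
      using Suc R[of k] R'[of "Suc k"] by (simp add: add_mem const_mem)
  qed
qed

lemma shift_mem:
  assumes "\<And>i. coeff P i \<in> V i"
  shows "coeff (shift \<alpha> P) j \<in> V j"
  using pcompose_linear_mem[of P 0 "- \<alpha>" j] assms by (simp add: shift_def)

lemma of_nat_mem: "r \<in> V j \<Longrightarrow> of_nat n * r \<in> V j"
  by (simp add: rf_of_nat const_mem)

text \<open>The matrix of Stirling numbers is unitriangular, hence invertible over the filtration.\<close>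

lemma stirling_mem_iff:
  assumes "\<And>j. j > n \<Longrightarrow> p j = 0"
  shows "(\<forall>j. (\<Sum>k\<le>n. of_nat (Stirling k j) * p k) \<in> V j) \<longleftrightarrow> (\<forall>j. p j \<in> V j)"
proof
  assume p: "\<forall>j. p j \<in> V j"
  have "of_nat (Stirling k j) * p k \<in> V j" for j k
  proof (cases "j \<le> k")
    case True
    then show ?thesis using p decreasing[of j k] of_nat_mem by blast
  next
    case False
    then show ?thesis by (simp add: Stirling_less zero_mem)
  qed
  then show "\<forall>j. (\<Sum>k\<le>n. of_nat (Stirling k j) * p k) \<in> V j"
    by (blast intro: sum_mem)
next
  let ?s = "\<lambda>j. \<Sum>k\<le>n. of_nat (Stirling k j) * p k"
  assume s: "\<forall>j. ?s j \<in> V j"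
  have "p j \<in> V j" for j
  proof (induction "n - j" arbitrary: j rule: less_induct)
    case less
    show ?case
    proof (cases "j \<le> n")
      case False
      then show ?thesis using assms by (simp add: zero_mem)
    next
      case True
      have "?s j = of_nat (Stirling j j) * p j + (\<Sum>k\<in>{..n} - {j}. of_nat (Stirling k j) * p k)"
        using True by (intro sum.remove) auto
      then have eq: "p j = ?s j + rf_const (- 1) * (\<Sum>k\<in>{..n} - {j}. of_nat (Stirling k j) * p k)"
        using rf_of_poly_minus[of 1] by (simp add: rf_of_poly_1 one_pCons)
      have "of_nat (Stirling k j) * p k \<in> V j" if "k \<in> {..n} - {j}" for k
      proof (cases "j < k")
        case True
        then have "p k \<in> V k" using less that by auto
        then show ?thesis using True decreasing[of j k] of_nat_mem by auto
      next
        case False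
        then show ?thesis using that by (simp add: Stirling_less zero_mem)
      qed
      then have "(\<Sum>k\<in>{..n} - {j}. of_nat (Stirling k j) * p k) \<in> V j"
        by (rule sum_mem)
      then show ?thesis
        using s by (subst eq) (intro add_mem const_mem, blast+)
    qed
  qed
  then show "\<forall>j. p j \<in> V j" ..
qed

end

lemma filtration_fuchs: "coeff_filtration (\<lambda>j. {r. pole_le (n - j) a r})"
  by standard (auto intro: pole_le_add pole_le_mult_const pole_le_mono diff_le_mono2)

lemma filtration_regular: "coeff_filtration (\<lambda>j. {r. pole_le 0 a r})"
  by standard (auto intro: pole_le_add pole_le_mult_const)

lemma filtration_infinity: "coeff_filtration (\<lambda>j. {r. pole_free_at_infinity r})"
proof standard
  show "0 \<in> {r. pole_free_at_infinity r}"
    using pole_free_at_infinity_const[of 0] by (simp add: rf_of_poly_0)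
qed (auto intro: pole_free_at_infinity_add pole_free_at_infinity_mult)

section \<open>The Fuchs conditions in powers of \<Theta>\<close>

definition fuchs_condition :: "diffop \<Rightarrow> complex \<Rightarrow> bool" where
  "fuchs_condition P a \<longleftrightarrow> (\<forall>j<degree P. rf_pole_order a (d_coeff P j) \<le> degree P - j)"

lemma fuchs_condition_iff:
  "fuchs_condition P a \<longleftrightarrow> (singular_point P a \<longrightarrow> regular_singular_point P a)"
  unfolding fuchs_condition_def regular_singular_point_def singular_point_def by auto

definition stirling_coeff :: "diffop \<Rightarrow> nat \<Rightarrow> ratfun" where
  "stirling_coeff P j = (\<Sum>k\<le>degree P. of_nat (Stirling k j) * coeff P k)"

lemma d_coeff_eq: "d_coeff P j = stirling_coeff P j / rf_t ^ (degree P - j)"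
  by (simp add: d_coeff_def stirling_coeff_def)

text \<open>The sum is 1 for \<open>j = degree P\<close> and 0 beyond. Bounds for
  \<open>j < degree P\<close> thus extend to all \<open>j\<close>, which is the range used by the
  Stirling inversion.\<close>

lemma stirling_coeff_beyond:
  assumes "lead_coeff P = 1" "j \<ge> degree P"
  shows "pole_le k a (stirling_coeff P j)"
proof -
  have "pole_le k a (of_nat (Stirling i j) * coeff P i)" if "i \<le> degree P" for i
  proof (cases "i = degree P")
    case False
    then have "Stirling i j = 0" using that assms by (intro Stirling_less) simp
    then show ?thesis by simp
  qed (use assms in simp)
  then show ?thesis
    unfolding stirling_coeff_def by (intro pole_le_sum) simp
qed

lemma fuchs_condition_nonzero:
  assumes "lead_coeff P = 1" "a \<noteq> 0"
  shows "fuchs_condition P a \<longleftrightarrow> (\<forall>j. pole_le (degree P - j) a (coeff P j))"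
proof -
  interpret coeff_filtration "\<lambda>j. {r. pole_le (degree P - j) a r}"
    by (rule filtration_fuchs)
  have "fuchs_condition P a \<longleftrightarrow> (\<forall>j<degree P. pole_le (degree P - j) a (stirling_coeff P j))"
    unfolding fuchs_condition_def d_coeff_eq using assms
    by (simp add: pole_le_divide_t flip: pole_le_iff)
  also have "\<dots> \<longleftrightarrow> (\<forall>j. pole_le (degree P - j) a (stirling_coeff P j))"
    using assms stirling_coeff_beyond not_le by blast
  also have "\<dots> \<longleftrightarrow> (\<forall>j. pole_le (degree P - j) a (coeff P j))"
    using stirling_mem_iff[of "degree P" "coeff P"] by (simp add: stirling_coeff_def coeff_eq_0)
  finally show ?thesis .
qed

text \<open>The divisor \<open>t ^ (degree P - j)\<close> already uses up the whole pole order
  allowed at 0, so nothing is left for the \<Theta>-coefficients.\<close>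

lemma fuchs_condition_zero:
  assumes "lead_coeff P = 1"
  shows "fuchs_condition P 0 \<longleftrightarrow> (\<forall>j. pole_le 0 0 (coeff P j))"
proof -
  interpret coeff_filtration "\<lambda>j. {r. pole_le 0 0 r}"
    by (rule filtration_regular)
  have "fuchs_condition P 0 \<longleftrightarrow> (\<forall>j<degree P. pole_le 0 0 (stirling_coeff P j))"
    unfolding fuchs_condition_def d_coeff_eq using assms
    by (simp add: pole_le_divide_t_0 flip: pole_le_iff)
  also have "\<dots> \<longleftrightarrow> (\<forall>j. pole_le 0 0 (stirling_coeff P j))"
    using assms stirling_coeff_beyond not_le by blast
  also have "\<dots> \<longleftrightarrow> (\<forall>j. pole_le 0 0 (coeff P j))"
    using stirling_mem_iff[of "degree P" "coeff P"] by (simp add: stirling_coeff_def coeff_eq_0)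
  finally show ?thesis .
qed

lemma not_singular_point_iff:
  assumes "lead_coeff P = 1" "a \<noteq> 0"
  shows "\<not> singular_point P a \<longleftrightarrow> (\<forall>j. pole_le 0 a (coeff P j))"
proof -
  interpret coeff_filtration "\<lambda>j. {r. pole_le 0 a r}"
    by (rule filtration_regular)
  have "\<not> singular_point P a \<longleftrightarrow> (\<forall>j<degree P. pole_le 0 a (stirling_coeff P j))"
    using assms unfolding singular_point_def d_coeff_eq
    by (simp add: pole_le_iff[symmetric] pole_le_divide_t flip: le_zero_eq)
  also have "\<dots> \<longleftrightarrow> (\<forall>j. pole_le 0 a (stirling_coeff P j))"
    using assms stirling_coeff_beyond not_le by blast
  also have "\<dots> \<longleftrightarrow> (\<forall>j. pole_le 0 a (coeff P j))"
    using stirling_mem_iff[of "degree P" "coeff P"] by (simp add: stirling_coeff_def coeff_eq_0)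
  finally show ?thesis .
qed

lemma rf_reciprocal_arg_0 [simp]: "rf_reciprocal_arg 0 = 0"
  unfolding rf_reciprocal_arg_def by (simp add: rf_num_def rf_den_def rf_of_poly_hom)

lemma rf_reciprocal_arg_1 [simp]: "rf_reciprocal_arg 1 = 1"
  unfolding rf_reciprocal_arg_def by (simp add: rf_num_def rf_den_def rf_of_poly_hom)

lemma coeff_at_infinity_op:
  "coeff (at_infinity_op P) j = (if j \<le> degree P then (- 1) ^ (degree P - j) * rf_reciprocal_arg (coeff P j) else 0)"
  unfolding at_infinity_op_def by (simp add: coeff_sum if_distrib[of "\<lambda>x. x = _"] sum.delta)

lemma at_infinity_op_monic:
  assumes "lead_coeff P = 1"
  shows "degree (at_infinity_op P) = degree P" "lead_coeff (at_infinity_op P) = 1"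
proof -
  have 1: "coeff (at_infinity_op P) (degree P) = 1"
    using assms by (simp add: coeff_at_infinity_op)
  show 2: "degree (at_infinity_op P) = degree P"
  proof (rule antisym)
    show "degree (at_infinity_op P) \<le> degree P"
      by (rule degree_le) (simp add: coeff_at_infinity_op)
    show "degree P \<le> degree (at_infinity_op P)"
      using 1 by (intro le_degree) simp
  qed
  show "lead_coeff (at_infinity_op P) = 1" using 1 2 by simp
qed

lemma fuchs_condition_infinity:
  assumes "lead_coeff P = 1"
  shows "fuchs_condition (at_infinity_op P) 0 \<longleftrightarrow> (\<forall>j. pole_free_at_infinity (coeff P j))"
proof -
  have sgn: "pole_le 0 0 ((- 1) ^ m * r) \<longleftrightarrow> pole_le 0 0 r" for m r
    by (cases "even m") simp_all
  have "fuchs_condition (at_infinity_op P) 0 \<longleftrightarrow> (\<forall>j. pole_le 0 0 (coeff (at_infinity_op P) j))"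
    using fuchs_condition_zero at_infinity_op_monic assms by blast
  also have "\<dots> \<longleftrightarrow> (\<forall>j. pole_le 0 0 (rf_reciprocal_arg (coeff P j)))"
    by (auto simp: coeff_at_infinity_op sgn coeff_eq_0 not_le split: if_splits)
       (metis coeff_eq_0 not_le pole_le_simps(1) rf_reciprocal_arg_0)+
  finally show ?thesis by (simp add: pole_free_at_infinity_iff)
qed

lemma fuchsian_iff:
  assumes "lead_coeff P = 1"
  shows "fuchsian P \<longleftrightarrow>
    (\<forall>a. a \<noteq> 0 \<longrightarrow> (\<forall>j. pole_le (degree P - j) a (coeff P j))) \<and>
    (\<forall>j. pole_le 0 0 (coeff P j)) \<and> (\<forall>j. pole_free_at_infinity (coeff P j))"
  unfolding fuchsian_def fuchs_condition_iff[symmetric] fuchs_condition_infinity[OF assms]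
  using fuchs_condition_nonzero[OF assms] fuchs_condition_zero[OF assms] by metis

lemma fuchsian_shift:
  assumes "order4_operator P" "fuchsian P"
  shows "fuchsian (shift \<alpha> P)"
proof -
  have P: "lead_coeff P = 1" and S: "lead_coeff (shift \<alpha> P) = 1"
    using assms order4_operator_shift unfolding order4_operator_def by blast+
  show ?thesis
    using assms(2) unfolding fuchsian_iff[OF P] fuchsian_iff[OF S]
    using coeff_filtration.shift_mem[OF filtration_fuchs, of P]
      coeff_filtration.shift_mem[OF filtration_regular, of P]
      coeff_filtration.shift_mem[OF filtration_infinity, of P] by simp
qed

text \<open>One inclusion suffices: for the shifted operator and \<open>- \<alpha>\<close> it
  becomes the other one.\<close>

lemma regular_locus_shift:
  assumes "order4_operator P"
  shows "regular_locus (shift \<alpha> P) = regular_locus P"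
proof -
  have sub: "regular_locus Q \<subseteq> regular_locus (shift \<beta> Q)" if "order4_operator Q" for Q \<beta>
  proof
    fix a assume a: "a \<in> regular_locus Q"
    have Q: "lead_coeff Q = 1" and S: "lead_coeff (shift \<beta> Q) = 1"
      using that order4_operator_shift unfolding order4_operator_def by blast+
    have "a \<noteq> 0" "\<not> singular_point Q a"
      using a by (auto simp: regular_locus_def)
    then have "\<not> singular_point (shift \<beta> Q) a"
      using coeff_filtration.shift_mem[OF filtration_regular, of Q]
      by (simp add: not_singular_point_iff[OF Q] not_singular_point_iff[OF S])
    then show "a \<in> regular_locus (shift \<beta> Q)"
      using \<open>a \<noteq> 0\<close> by (simp add: regular_locus_def)
  qed
  show ?thesis
    using sub[OF assms] sub[OF order4_operator_shift[OF assms], of \<alpha> "- \<alpha>"] by auto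
qed

lemma regular_locus_coeff:
  assumes "order4_operator P" "a \<in> regular_locus P"
  shows "a \<noteq> 0" "pole_le 0 a (coeff P j)"
  using assms not_singular_point_iff[of P a]
  unfolding regular_locus_def order4_operator_def by auto

lemma finite_compl_regular_locus: "finite (- regular_locus P)"
proof -
  have "{a. singular_point P a} \<subseteq> (\<Union>j<degree P. {a. poly (rf_den (d_coeff P j)) a = 0})"
    unfolding singular_point_def rf_pole_order_def
    by (auto simp: order_root)
  moreover have "finite \<dots>"
    by (intro finite_UN_I) (auto simp: poly_roots_finite)
  ultimately have "finite {a. singular_point P a}"
    by (rule finite_subset)
  then show ?thesis
    by (simp add: regular_locus_def)
qed

lemma open_regular_locus: "open (regular_locus P)"
  using finite_compl_regular_locus[of P] by (simp add: finite_imp_closed open_closed)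

section \<open>Analytic continuation\<close>

text \<open>\<open>continues_along\<close> freed from the interval \<open>{0..1}\<close>, so that
  continuations can be restricted, glued and reparametrised.\<close>

definition cont_on ::
  "(real \<Rightarrow> complex) \<Rightarrow> real \<Rightarrow> real \<Rightarrow> (complex \<Rightarrow> complex) \<Rightarrow> (complex \<Rightarrow> complex) \<Rightarrow> bool" where
  "cont_on \<gamma> a b f g \<longleftrightarrow>
     (\<exists>F :: real \<Rightarrow> complex \<Rightarrow> complex.
        (\<forall>s\<in>{a..b}. F s analytic_on {\<gamma> s}) \<and>
        (\<forall>s\<in>{a..b}. \<forall>\<^sub>F s' in at s within {a..b}. \<forall>\<^sub>F z in nhds (\<gamma> s'). F s' z = F s z) \<and>
        (\<forall>\<^sub>F z in nhds (\<gamma> a). F a z = f z) \<and>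
        (\<forall>\<^sub>F z in nhds (\<gamma> b). F b z = g z))"

lemma continues_along_iff: "continues_along \<gamma> f g \<longleftrightarrow> cont_on \<gamma> 0 1 f g"
  by (simp add: continues_along_def cont_on_def pathstart_def pathfinish_def)

lemma cont_on_cong:
  assumes "cont_on \<gamma> a b f g" "a \<le> b" "\<And>s. s \<in> {a..b} \<Longrightarrow> \<gamma> s = \<delta> s"
    and "\<forall>\<^sub>F z in nhds (\<gamma> a). f z = f' z" "\<forall>\<^sub>F z in nhds (\<gamma> b). g z = g' z"
  shows "cont_on \<delta> a b f' g'"
proof -
  obtain F where F: "\<forall>s\<in>{a..b}. F s analytic_on {\<gamma> s}"
    "\<forall>s\<in>{a..b}. \<forall>\<^sub>F s' in at s within {a..b}. \<forall>\<^sub>F z in nhds (\<gamma> s'). F s' z = F s z"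
    "\<forall>\<^sub>F z in nhds (\<gamma> a). F a z = f z" "\<forall>\<^sub>F z in nhds (\<gamma> b). F b z = g z"
    using assms(1) unfolding cont_on_def by blast
  have "\<forall>\<^sub>F s' in at s within {a..b}. \<forall>\<^sub>F z in nhds (\<delta> s'). F s' z = F s z" if "s \<in> {a..b}" for s
  proof -
    have "\<forall>\<^sub>F s' in at s within {a..b}. s' \<in> {a..b}"
      by (simp add: eventually_at_filter)
    with bspec[OF F(2) that] show ?thesis
      by eventually_elim (simp add: assms(3))
  qed
  moreover have "\<forall>s\<in>{a..b}. F s analytic_on {\<delta> s}"
    using F(1) assms(3) by metis
  moreover have "\<forall>\<^sub>F z in nhds (\<delta> a). F a z = f' z"
    using F(3) assms(4) assms(2) assms(3)[of a] by (auto elim: eventually_elim2)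
  moreover have "\<forall>\<^sub>F z in nhds (\<delta> b). F b z = g' z"
    using F(4) assms(5) assms(2) assms(3)[of b] by (auto elim: eventually_elim2)
  ultimately show ?thesis
    unfolding cont_on_def by blast
qed

lemma cont_on_const:
  assumes "\<And>s. s \<in> {a..b} \<Longrightarrow> f analytic_on {\<gamma> s}"
  shows "cont_on \<gamma> a b f f"
  unfolding cont_on_def using assms by (intro exI[of _ "\<lambda>_. f"]) simp

text \<open>One argument for sums and products: an operation that preserves analyticity can be
  applied to the two families of germs at each time.\<close>

lemma cont_on_compose:
  fixes op :: "complex \<Rightarrow> complex \<Rightarrow> complex"
  assumes "cont_on \<gamma> a b f1 g1" "cont_on \<gamma> a b f2 g2"
    and op: "\<And>p q S. p analytic_on S \<Longrightarrow> q analytic_on S \<Longrightarrow> (\<lambda>z. op (p z) (q z)) analytic_on S"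
  shows "cont_on \<gamma> a b (\<lambda>z. op (f1 z) (f2 z)) (\<lambda>z. op (g1 z) (g2 z))"
proof -
  obtain F where F: "\<forall>s\<in>{a..b}. F s analytic_on {\<gamma> s}"
    "\<forall>s\<in>{a..b}. \<forall>\<^sub>F s' in at s within {a..b}. \<forall>\<^sub>F z in nhds (\<gamma> s'). F s' z = F s z"
    "\<forall>\<^sub>F z in nhds (\<gamma> a). F a z = f1 z" "\<forall>\<^sub>F z in nhds (\<gamma> b). F b z = g1 z"
    using assms(1) unfolding cont_on_def by blast
  obtain G where G: "\<forall>s\<in>{a..b}. G s analytic_on {\<gamma> s}"
    "\<forall>s\<in>{a..b}. \<forall>\<^sub>F s' in at s within {a..b}. \<forall>\<^sub>F z in nhds (\<gamma> s'). G s' z = G s z"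
    "\<forall>\<^sub>F z in nhds (\<gamma> a). G a z = f2 z" "\<forall>\<^sub>F z in nhds (\<gamma> b). G b z = g2 z"
    using assms(2) unfolding cont_on_def by blast
  have "\<forall>\<^sub>F s' in at s within {a..b}. \<forall>\<^sub>F z in nhds (\<gamma> s'). op (F s' z) (G s' z) = op (F s z) (G s z)"
    if "s \<in> {a..b}" for s
    using bspec[OF F(2) that] bspec[OF G(2) that]
    by eventually_elim (auto elim: eventually_elim2)
  moreover have "\<forall>\<^sub>F z in nhds (\<gamma> a). op (F a z) (G a z) = op (f1 z) (f2 z)"
    using F(3) G(3) by eventually_elim simp
  moreover have "\<forall>\<^sub>F z in nhds (\<gamma> b). op (F b z) (G b z) = op (g1 z) (g2 z)"
    using F(4) G(4) by eventually_elim simp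
  ultimately show ?thesis
    unfolding cont_on_def using F(1) G(1) op
    by (intro exI[of _ "\<lambda>s z. op (F s z) (G s z)"]) simp
qed

lemma cont_on_add: "cont_on \<gamma> a b f1 g1 \<Longrightarrow> cont_on \<gamma> a b f2 g2 \<Longrightarrow>
    cont_on \<gamma> a b (\<lambda>z. f1 z + f2 z) (\<lambda>z. g1 z + g2 z)"
  by (rule cont_on_compose) (auto intro: analytic_intros)

lemma cont_on_mult: "cont_on \<gamma> a b f1 g1 \<Longrightarrow> cont_on \<gamma> a b f2 g2 \<Longrightarrow>
    cont_on \<gamma> a b (\<lambda>z. f1 z * f2 z) (\<lambda>z. g1 z * g2 z)"
  by (rule cont_on_compose) (auto intro: analytic_intros)

lemma cont_on_cmult: "cont_on \<gamma> a b f g \<Longrightarrow> cont_on \<gamma> a b (\<lambda>z. c * f z) (\<lambda>z. c * g z)"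
  using cont_on_mult[OF cont_on_const[of a b "\<lambda>_. c" \<gamma>]] by simp

lemma cont_on_sum:
  "(\<And>i. i \<in> I \<Longrightarrow> cont_on \<gamma> a b (f i) (g i)) \<Longrightarrow>
    cont_on \<gamma> a b (\<lambda>z. \<Sum>i\<in>I. f i z) (\<lambda>z. \<Sum>i\<in>I. g i z)"
proof (induction I rule: infinite_finite_induct)
  case (insert x I)
  then show ?case
    using cont_on_add[of \<gamma> a b "f x" "g x" "\<lambda>z. \<Sum>i\<in>I. f i z" "\<lambda>z. \<Sum>i\<in>I. g i z"] by simp
qed (auto intro: cont_on_const)

text \<open>At the joint the two families agree only as germs at \<open>\<gamma> b\<close>, while
  just after it germs at the moved centre \<open>\<gamma> s'\<close> are compared. Continuity of
  \<open>\<gamma>\<close> keeps these centres inside an open set on which the functions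
  agree.\<close>

lemma cont_on_trans:
  assumes "cont_on \<gamma> a b f g" "cont_on \<gamma> b c g h" "a \<le> b" "b \<le> c" "continuous_on {a..c} \<gamma>"
  shows "cont_on \<gamma> a c f h"
proof -
  obtain F where F: "\<forall>s\<in>{a..b}. F s analytic_on {\<gamma> s}"
    "\<forall>s\<in>{a..b}. \<forall>\<^sub>F s' in at s within {a..b}. \<forall>\<^sub>F z in nhds (\<gamma> s'). F s' z = F s z"
    "\<forall>\<^sub>F z in nhds (\<gamma> a). F a z = f z" "\<forall>\<^sub>F z in nhds (\<gamma> b). F b z = g z"
    using assms(1) unfolding cont_on_def by blast
  obtain G where G: "\<forall>s\<in>{b..c}. G s analytic_on {\<gamma> s}"
    "\<forall>s\<in>{b..c}. \<forall>\<^sub>F s' in at s within {b..c}. \<forall>\<^sub>F z in nhds (\<gamma> s'). G s' z = G s z"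
    "\<forall>\<^sub>F z in nhds (\<gamma> b). G b z = g z" "\<forall>\<^sub>F z in nhds (\<gamma> c). G c z = h z"
    using assms(2) unfolding cont_on_def by blast
  define H where "H s = (if s \<le> b then F s else G s)" for s
  have FG: "\<forall>\<^sub>F z in nhds (\<gamma> b). F b z = G b z"
    using F(4) G(3) by eventually_elim simp
  have GH: "\<forall>\<^sub>F z in nhds (\<gamma> b). G b z = H b z"
    using FG by eventually_elim (simp add: H_def)
  have loc: "\<forall>\<^sub>F s' in at s within {a..c}. \<forall>\<^sub>F z in nhds (\<gamma> s'). H s' z = H s z" if s: "s \<in> {a..c}" for s
  proof -
    have I: "{a..c} = {a..b} \<union> {b..c}" using assms by auto
    have 1: "\<forall>\<^sub>F s' in at s within {a..b}. \<forall>\<^sub>F z in nhds (\<gamma> s'). H s' z = H s z"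
    proof (cases "s \<le> b")
      case True
      have "\<forall>\<^sub>F s' in at s within {a..b}. s' \<in> {a..b}"
        by (simp add: eventually_at_filter)
      moreover have "\<forall>\<^sub>F s' in at s within {a..b}. \<forall>\<^sub>F z in nhds (\<gamma> s'). F s' z = F s z"
        using F(2) s True by simp
      ultimately show ?thesis
        by eventually_elim (simp add: H_def True)
    next
      case False
      then have "at s within {a..b} = bot"
        by (simp add: at_within_eq_bot_iff)
      then show ?thesis by simp
    qed
    have 2: "\<forall>\<^sub>F s' in at s within {b..c}. \<forall>\<^sub>F z in nhds (\<gamma> s'). H s' z = H s z"
    proof -
      consider "s < b" | "s = b" | "s > b" by linarith
      then show ?thesis
      proof cases
        case 1
        then have "at s within {b..c} = bot"
          by (simp add: at_within_eq_bot_iff)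
        then show ?thesis by simp
      next
        case 2
        obtain U where U: "open U" "\<gamma> b \<in> U" "\<And>z. z \<in> U \<Longrightarrow> G b z = H b z"
          using GH unfolding eventually_nhds by blast
        have "continuous_on {b..c} \<gamma>"
          using assms by (auto intro: continuous_on_subset)
        then have "(\<gamma> \<longlongrightarrow> \<gamma> b) (at b within {b..c})"
          using assms by (simp add: continuous_on_def)
        then have "\<forall>\<^sub>F s' in at b within {b..c}. \<gamma> s' \<in> U"
          using U topological_tendstoD by blast
        moreover have "\<forall>\<^sub>F s' in at b within {b..c}. s' \<in> {b..c} - {b}"
          by (simp add: eventually_at_filter)
        moreover have "\<forall>\<^sub>F s' in at b within {b..c}. \<forall>\<^sub>F z in nhds (\<gamma> s'). G s' z = G b z"
          using G(2) assms by simp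
        ultimately show ?thesis
          unfolding 2
        proof eventually_elim
          case (elim s')
          have "\<forall>\<^sub>F z in nhds (\<gamma> s'). z \<in> U"
            using U elim by (simp add: eventually_nhds_in_open)
          moreover have "H s' = G s'"
            using elim(2) by (auto simp: H_def)
          ultimately show ?case
            using elim(3) by (auto elim: eventually_elim2 simp: U(3))
        qed
      next
        case 3
        have "\<forall>\<^sub>F s' in at s within {b..c}. s' > b"
          using 3 order_tendstoD(1)[OF tendsto_ident_at, of b s] by simp
        moreover have "\<forall>\<^sub>F s' in at s within {b..c}. \<forall>\<^sub>F z in nhds (\<gamma> s'). G s' z = G s z"
          using G(2) s 3 by simp
        ultimately show ?thesis
          by eventually_elim (use 3 in \<open>simp add: H_def\<close>)
      qed
    qed
    show ?thesis
      unfolding I at_within_union eventually_sup using 1 2 by simp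
  qed
  have an: "H s analytic_on {\<gamma> s}" if "s \<in> {a..c}" for s
    using F(1) G(1) that by (simp add: H_def)
  have start: "\<forall>\<^sub>F z in nhds (\<gamma> a). H a z = f z"
    using F(3) assms by (simp add: H_def)
  have fin: "\<forall>\<^sub>F z in nhds (\<gamma> c). H c z = h z"
  proof (cases "b = c")
    case True
    then show ?thesis using GH G(4) by (auto elim: eventually_elim2)
  next
    case False
    then show ?thesis using G(4) assms by (simp add: H_def)
  qed
  show ?thesis
    unfolding cont_on_def using loc an start fin by (intro exI[of _ H]) blast
qed

lemma cont_on_reparam:
  assumes "cont_on \<gamma> a b f g" and m: "m > 0"
  shows "cont_on (\<lambda>s. \<gamma> (m * s + d)) ((a - d) / m) ((b - d) / m) f g"
proof -
  obtain F where F: "\<forall>s\<in>{a..b}. F s analytic_on {\<gamma> s}"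
    "\<forall>s\<in>{a..b}. \<forall>\<^sub>F s' in at s within {a..b}. \<forall>\<^sub>F z in nhds (\<gamma> s'). F s' z = F s z"
    "\<forall>\<^sub>F z in nhds (\<gamma> a). F a z = f z" "\<forall>\<^sub>F z in nhds (\<gamma> b). F b z = g z"
    using assms(1) unfolding cont_on_def by blast
  let ?I = "{(a - d) / m..(b - d) / m}"
  have mem: "m * s + d \<in> {a..b} \<longleftrightarrow> s \<in> ?I" for s
    using m by (auto simp: field_simps)
  have "\<forall>\<^sub>F s' in at s within ?I. \<forall>\<^sub>F z in nhds (\<gamma> (m * s' + d)). F (m * s' + d) z = F (m * s + d) z"
    if s: "s \<in> ?I" for s
  proof -
    have "filterlim (\<lambda>s'. m * s' + d) (at (m * s + d) within {a..b}) (at s within ?I)"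
      unfolding filterlim_at
    proof
      show "\<forall>\<^sub>F x in at s within ?I. m * x + d \<in> {a..b} \<and> m * x + d \<noteq> m * s + d"
        unfolding mem using m by (simp add: eventually_at_filter)
      show "((\<lambda>s'. m * s' + d) \<longlongrightarrow> m * s + d) (at s within ?I)"
        by (intro tendsto_intros)
    qed
    then show ?thesis
      using F(2) s mem unfolding filterlim_iff by blast
  qed
  then show ?thesis
    unfolding cont_on_def using F(1,3,4) m mem
    by (intro exI[of _ "\<lambda>s. F (m * s + d)"]) simp
qed

lemma cont_on_uminus:
  assumes "cont_on \<gamma> a b f g"
  shows "cont_on (\<lambda>s. \<gamma> (- s)) (- b) (- a) g f"
proof -
  obtain F where F: "\<forall>s\<in>{a..b}. F s analytic_on {\<gamma> s}"
    "\<forall>s\<in>{a..b}. \<forall>\<^sub>F s' in at s within {a..b}. \<forall>\<^sub>F z in nhds (\<gamma> s'). F s' z = F s z"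
    "\<forall>\<^sub>F z in nhds (\<gamma> a). F a z = f z" "\<forall>\<^sub>F z in nhds (\<gamma> b). F b z = g z"
    using assms(1) unfolding cont_on_def by blast
  let ?I = "{- b..- a}"
  have mem: "- s \<in> {a..b} \<longleftrightarrow> s \<in> ?I" for s
    by auto
  have "\<forall>\<^sub>F s' in at s within ?I. \<forall>\<^sub>F z in nhds (\<gamma> (- s')). F (- s') z = F (- s) z"
    if s: "s \<in> ?I" for s
  proof -
    have "filterlim uminus (at (- s) within {a..b}) (at s within ?I)"
      unfolding filterlim_at
    proof
      show "\<forall>\<^sub>F x in at s within ?I. - x \<in> {a..b} \<and> - x \<noteq> - s"
        unfolding mem by (simp add: eventually_at_filter)
      show "(uminus \<longlongrightarrow> - s) (at s within ?I)"
        by (intro tendsto_intros)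
    qed
    then show ?thesis
      using F(2) s mem unfolding filterlim_iff by blast
  qed
  then show ?thesis
    unfolding cont_on_def using F(1,3,4) mem
    by (intro exI[of _ "\<lambda>s. F (- s)"]) simp
qed

lemma continues_along_reversepath:
  assumes "continues_along \<gamma> f g"
  shows "continues_along (reversepath \<gamma>) g f"
proof -
  have "cont_on (\<lambda>s. \<gamma> (- s)) (- 1) 0 g f"
    using cont_on_uminus[of \<gamma> 0 1 f g] assms by (simp add: continues_along_iff)
  from cont_on_reparam[OF this, of 1 "- 1"] show ?thesis
    by (simp add: continues_along_iff reversepath_def[abs_def])
qed

lemma continues_along_join:
  assumes "continues_along \<gamma> f g" "continues_along \<delta> g h" "path \<gamma>" "path \<delta>" "pathfinish \<gamma> = pathstart \<delta>"
  shows "continues_along (\<gamma> +++ \<delta>) f h"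
proof -
  have "cont_on (\<lambda>s. \<gamma> (2 * s)) 0 (1 / 2) f g"
    using cont_on_reparam[of \<gamma> 0 1 f g 2 0] assms by (simp add: continues_along_iff)
  then have 1: "cont_on (\<gamma> +++ \<delta>) 0 (1 / 2) f g"
    by (rule cont_on_cong) (auto simp: joinpaths_def)
  have "cont_on (\<lambda>s. \<delta> (2 * s - 1)) (1 / 2) 1 g h"
    using cont_on_reparam[of \<delta> 0 1 g h 2 "- 1"] assms by (simp add: continues_along_iff)
  then have 2: "cont_on (\<gamma> +++ \<delta>) (1 / 2) 1 g h"
    by (rule cont_on_cong)
      (use assms(5) in \<open>auto simp: joinpaths_def pathstart_def pathfinish_def field_simps\<close>)
  show ?thesis
    unfolding continues_along_iff
    using cont_on_trans[OF 1 2] assms path_join[of \<gamma> \<delta>] unfolding path_def by simp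
qed

text \<open>A branch of \<open>t \<mapsto> t\<^sup>\<alpha>\<close> near \<open>b\<close>, normalised to be \<open>1\<close> at \<open>b\<close>.\<close>

definition powr_germ :: "complex \<Rightarrow> complex \<Rightarrow> complex \<Rightarrow> complex" where
  "powr_germ \<alpha> b z = exp (\<alpha> * Ln (z / b))"

lemma powr_germ_uminus: "powr_germ (- \<alpha>) b z * powr_germ \<alpha> b z = 1"
  by (simp add: powr_germ_def flip: exp_add)

lemma powr_germ_holomorphic:
  assumes "b \<noteq> 0"
  shows "powr_germ \<alpha> b holomorphic_on ball b (norm b)"
    and "z \<in> ball b (norm b) \<Longrightarrow> theta (powr_germ \<alpha> b) z = \<alpha> * powr_germ \<alpha> b z"
proof -
  have D: "(powr_germ \<alpha> b has_field_derivative \<alpha> / z * powr_germ \<alpha> b z) (at z)"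
    if "z \<in> ball b (norm b)" for z
  proof -
    have "z / b - 1 = (z - b) / b"
      using assms by (simp add: diff_divide_distrib)
    \<comment> \<open>\<open>z / b\<close> stays in the open unit disc about 1, which avoids the
      branch cut of \<open>Ln\<close>.\<close>
    then have "norm (z / b - 1) < 1"
      using that assms by (simp add: dist_norm norm_divide norm_minus_commute)
    then have "z / b \<notin> \<real>\<^sub>\<le>\<^sub>0"
      using abs_Re_le_cmod[of "z / b - 1"] unfolding complex_nonpos_Reals_iff by auto
    moreover have "z \<noteq> 0" using that by auto
    ultimately show ?thesis
      unfolding powr_germ_def[abs_def] using assms
      by (auto intro!: derivative_eq_intros simp: field_simps)
  qed
  show "powr_germ \<alpha> b holomorphic_on ball b (norm b)"
    using D by (subst holomorphic_on_open) blast+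
  show "theta (powr_germ \<alpha> b) z = \<alpha> * powr_germ \<alpha> b z" if "z \<in> ball b (norm b)"
    using DERIV_imp_deriv[OF D[OF that]] that unfolding theta_def by auto
qed

lemma powr_germ_analytic: "b \<noteq> 0 \<Longrightarrow> powr_germ \<alpha> b analytic_on {b}"
  unfolding analytic_on_def using powr_germ_holomorphic(1)[of b \<alpha>] by (auto intro: exI[of _ "norm b"])

text \<open>\<open>\<psi>\<close> lifts \<open>\<gamma>\<close> to the logarithm. The branch reached
  at time \<open>s\<close> is the one normalised at \<open>\<gamma> s\<close>, times the factor
  \<open>exp (\<alpha> * (\<psi> s - \<psi> 0))\<close> accumulated so far.\<close>

lemma powr_germ_continues_along:
  assumes \<psi>: "continuous_on {0..1} \<psi>" and \<gamma>: "\<And>s. s \<in> {0..1} \<Longrightarrow> \<gamma> s = exp (\<psi> s)"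
  shows "continues_along \<gamma> (powr_germ \<alpha> (pathstart \<gamma>))
    (\<lambda>z. exp (\<alpha> * (\<psi> 1 - \<psi> 0)) * powr_germ \<alpha> (pathfinish \<gamma>) z)"
proof -
  define F where "F s z = exp (\<alpha> * (\<psi> s - \<psi> 0)) * powr_germ \<alpha> (\<gamma> s) z" for s z
  have nz: "\<gamma> s \<noteq> 0" if "s \<in> {0..1}" for s using \<gamma>[OF that] by simp
  have "\<forall>\<^sub>F s' in at s within {0..1}. \<forall>\<^sub>F z in nhds (\<gamma> s'). F s' z = F s z" if s: "s \<in> {0..1}" for s
  proof -
    have "(\<psi> \<longlongrightarrow> \<psi> s) (at s within {0..1})"
      using \<psi> s by (simp add: continuous_on_def)
    then have "\<forall>\<^sub>F s' in at s within {0..1}. dist (\<psi> s') (\<psi> s) < 1"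
      by (rule tendstoD) simp
    moreover have "\<forall>\<^sub>F s' in at s within {0..1}. s' \<in> {0..1}"
      by (simp add: eventually_at_filter)
    ultimately show ?thesis
    proof eventually_elim
      case (elim s')
      have "((\<lambda>z. z / \<gamma> s') \<longlongrightarrow> 1) (nhds (\<gamma> s'))"
        using nz[OF elim(2)] tendsto_divide[OF filterlim_ident[of "nhds (\<gamma> s')"] tendsto_const[of "\<gamma> s'"]]
        by simp
      then have "((\<lambda>z. Ln (z / \<gamma> s')) \<longlongrightarrow> Ln 1) (nhds (\<gamma> s'))"
        by (intro tendsto_Ln) simp_all
      then have "\<forall>\<^sub>F z in nhds (\<gamma> s'). dist (Ln (z / \<gamma> s')) (Ln 1) < 1"
        by (rule tendstoD) simp
      moreover have "\<forall>\<^sub>F z in nhds (\<gamma> s'). z \<noteq> 0"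
        using nz[OF elim(2)] by (rule t1_space_nhds)
      ultimately show ?case
      proof eventually_elim
        case (elim z)
        have z: "z / \<gamma> s = exp (\<psi> s' - \<psi> s + Ln (z / \<gamma> s'))"
          using elim nz \<open>s' \<in> {0..1}\<close> s by (simp add: exp_add exp_diff \<gamma>)
        have "norm (\<psi> s' - \<psi> s + Ln (z / \<gamma> s')) < 1 + 1"
          using \<open>dist (\<psi> s') (\<psi> s) < 1\<close> elim
          by (intro norm_triangle_lt add_strict_mono) (simp_all add: dist_norm)
        \<comment> \<open>Two summands of norm below 1 keep the imaginary part below 2, hence below
          pi. There \<open>Ln\<close> inverts \<open>exp\<close>, so the principal logarithms at the
          two centres differ by the change of \<open>\<psi>\<close> and not by a further
          period.\<close>
        then have "\<bar>Im (\<psi> s' - \<psi> s + Ln (z / \<gamma> s'))\<bar> < 2"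
          using abs_Im_le_cmod le_less_trans by fastforce
        then have eq: "Ln (z / \<gamma> s) = \<psi> s' - \<psi> s + Ln (z / \<gamma> s')"
          unfolding z using pi_gt3 by (intro Ln_exp) (simp_all add: abs_less_iff)
        have "\<alpha> * (\<psi> s' - \<psi> 0) + \<alpha> * Ln (z / \<gamma> s') =
            \<alpha> * (\<psi> s - \<psi> 0) + \<alpha> * Ln (z / \<gamma> s)"
          unfolding eq by (simp add: algebra_simps)
        then show "F s' z = F s z"
          unfolding F_def powr_germ_def exp_add[symmetric] by (simp only:)
      qed
    qed
  qed
  moreover have "F s analytic_on {\<gamma> s}" if "s \<in> {0..1}" for s
    unfolding F_def[abs_def] using powr_germ_analytic[OF nz[OF that]]
    by (intro analytic_intros)
  ultimately show ?thesis
    unfolding continues_along_iff cont_on_def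
    by (intro exI[of _ F]) (simp add: F_def pathstart_def pathfinish_def)
qed

text \<open>Over a closed path the lift changes by \<open>2 * pi * n * \<i>\<close>. The winding
  number \<open>n\<close> depends on the path only, so one \<open>n\<close> serves all
  \<open>\<alpha>\<close>.\<close>

lemma powr_germ_continues_along_loop:
  assumes "path \<gamma>" "pathstart \<gamma> = b" "pathfinish \<gamma> = b" "0 \<notin> path_image \<gamma>"
  obtains n :: int where
    "\<And>\<alpha>. continues_along \<gamma> (powr_germ \<alpha> b) (\<lambda>z. exp (2 * of_real pi * \<i> * \<alpha>) powi n * powr_germ \<alpha> b z)"
proof -
  obtain \<psi> where \<psi>: "continuous_on {0..1} \<psi>" "\<And>s. s \<in> {0..1} \<Longrightarrow> \<gamma> s = exp (\<psi> s)"
    using continuous_logarithm_on_contractible[of "{0..1}" \<gamma>] assms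
    unfolding path_def path_image_def by (metis convex_imp_contractible convex_real_interval(5) imageI)
  have "exp (\<psi> 1) = exp (\<psi> 0)"
    using \<psi>(2)[of 0] \<psi>(2)[of 1] assms by (simp add: pathstart_def pathfinish_def)
  then obtain n :: int where n: "\<psi> 1 = \<psi> 0 + (of_int (2 * n) * pi) * \<i>"
    unfolding exp_eq by blast
  have "exp (\<alpha> * (\<psi> 1 - \<psi> 0)) = exp (2 * of_real pi * \<i> * \<alpha>) powi n" for \<alpha>
    unfolding exp_power_int n by (simp add: algebra_simps)
  then show thesis
    using that[of n] powr_germ_continues_along[OF \<psi>] assms(2,3) by simp
qed

section \<open>Action of the shift on solutions\<close>

lemma apply_op_eq_sum:
  assumes "degree P \<le> n"
  shows "apply_op P y z = (\<Sum>i\<le>n. rf_eval (coeff P i) z * (theta ^^ i) y z)"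
  unfolding apply_op_def using assms
  by (intro sum.mono_neutral_left) (auto simp: coeff_eq_0 not_le)

lemma apply_op_0 [simp]: "apply_op 0 y z = 0"
  by (simp add: apply_op_def)

text \<open>Removing the constant term leaves an operator with one \<Theta> factored out on the
  right, which acts on \<open>y\<close> first. This recursion carries the induction over
  operators.\<close>

lemma apply_op_pCons: "apply_op (pCons a P) y z = rf_eval a z * y z + apply_op P (theta y) z"
proof -
  have "apply_op (pCons a P) y z = (\<Sum>i\<le>Suc (degree P). rf_eval (coeff (pCons a P) i) z * (theta ^^ i) y z)"
    by (intro apply_op_eq_sum degree_pCons_le)
  also have "\<dots> = rf_eval a z * y z + (\<Sum>i\<le>degree P. rf_eval (coeff P i) z * (theta ^^ Suc i) y z)"
    by (subst sum.atMost_Suc_shift) simp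
  also have "\<dots> = rf_eval a z * y z + apply_op P (theta y) z"
    unfolding apply_op_def by (simp only: funpow_Suc_right o_apply)
  finally show ?thesis .
qed

lemma apply_op_add:
  assumes "\<And>i. pole_le 0 z (coeff P i)" "\<And>i. pole_le 0 z (coeff Q i)"
  shows "apply_op (P + Q) y z = apply_op P y z + apply_op Q y z"
proof -
  let ?n = "max (degree P) (degree Q)"
  have "apply_op (P + Q) y z = (\<Sum>i\<le>?n. rf_eval (coeff (P + Q) i) z * (theta ^^ i) y z)"
    by (intro apply_op_eq_sum degree_add_le_max)
  then show ?thesis
    using apply_op_eq_sum[of P ?n y z] apply_op_eq_sum[of Q ?n y z] assms
    by (simp add: rf_eval_add algebra_simps sum.distrib)
qed

lemma apply_op_smult_const:
  assumes "\<And>i. pole_le 0 z (coeff P i)"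
  shows "apply_op (smult (rf_const c) P) y z = c * apply_op P y z"
proof -
  have "apply_op (smult (rf_const c) P) y z =
      (\<Sum>i\<le>degree P. rf_eval (coeff (smult (rf_const c) P) i) z * (theta ^^ i) y z)"
    by (intro apply_op_eq_sum degree_smult_le)
  then show ?thesis
    using assms by (simp add: apply_op_def rf_eval_mult sum_distrib_left mult.assoc)
qed

lemma theta_cong:
  assumes "open S" "\<And>z. z \<in> S \<Longrightarrow> f z = g z" "z \<in> S"
  shows "theta f z = theta g z"
proof -
  have "\<forall>\<^sub>F w in nhds z. f w = g w"
    using assms eventually_nhds by blast
  then show ?thesis
    unfolding theta_def using deriv_cong_ev by metis
qed

lemma funpow_theta_cong:
  assumes "open S" "\<And>z. z \<in> S \<Longrightarrow> f z = g z"
  shows "z \<in> S \<Longrightarrow> (theta ^^ i) f z = (theta ^^ i) g z"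
  by (induction i arbitrary: z) (auto intro: assms theta_cong[OF assms(1)])

lemma apply_op_cong:
  assumes "open S" "\<And>z. z \<in> S \<Longrightarrow> f z = g z" "z \<in> S"
  shows "apply_op P f z = apply_op P g z"
  unfolding apply_op_def using funpow_theta_cong[OF assms] by simp

lemma theta_holomorphic: "open S \<Longrightarrow> f holomorphic_on S \<Longrightarrow> theta f holomorphic_on S"
  unfolding theta_def by (intro holomorphic_intros) auto

lemma funpow_theta_holomorphic: "open S \<Longrightarrow> f holomorphic_on S \<Longrightarrow> (theta ^^ i) f holomorphic_on S"
  by (induction i) (auto intro: theta_holomorphic)

lemma theta_sum:
  assumes "open S" "\<And>k. k \<in> K \<Longrightarrow> f k holomorphic_on S" "z \<in> S"
  shows "theta (\<lambda>z. \<Sum>k\<in>K. c k * f k z) z = (\<Sum>k\<in>K. c k * theta (f k) z)"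
proof -
  have "(f k has_field_derivative deriv (f k) z) (at z)" if "k \<in> K" for k
    using that assms holomorphic_derivI by blast
  then have "((\<lambda>z. \<Sum>k\<in>K. c k * f k z) has_field_derivative (\<Sum>k\<in>K. c k * deriv (f k) z)) (at z)"
    by (auto intro!: derivative_eq_intros simp: mult.commute)
  then show ?thesis
    unfolding theta_def by (simp add: DERIV_imp_deriv sum_distrib_left mult_ac)
qed

lemma funpow_theta_sum:
  assumes "open S" "\<And>k. k \<in> K \<Longrightarrow> f k holomorphic_on S"
  shows "z \<in> S \<Longrightarrow> (theta ^^ i) (\<lambda>z. \<Sum>k\<in>K. c k * f k z) z = (\<Sum>k\<in>K. c k * (theta ^^ i) (f k) z)"
proof (induction i arbitrary: z)
  case (Suc i)
  have "theta ((theta ^^ i) (\<lambda>z. \<Sum>k\<in>K. c k * f k z)) z = theta (\<lambda>z. \<Sum>k\<in>K. c k * (theta ^^ i) (f k) z) z"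
    using Suc assms(1) by (intro theta_cong) auto
  also have "\<dots> = (\<Sum>k\<in>K. c k * theta ((theta ^^ i) (f k)) z)"
    using assms Suc.prems by (intro theta_sum) (auto intro: funpow_theta_holomorphic)
  finally show ?case by simp
qed simp

lemma apply_op_sum:
  assumes "open S" "\<And>k. k \<in> K \<Longrightarrow> f k holomorphic_on S" "z \<in> S"
  shows "apply_op P (\<lambda>z. \<Sum>k\<in>K. c k * f k z) z = (\<Sum>k\<in>K. c k * apply_op P (f k) z)"
proof -
  have "(theta ^^ i) (\<lambda>z. \<Sum>k\<in>K. c k * f k z) z = (\<Sum>k\<in>K. c k * (theta ^^ i) (f k) z)" for i
    using assms by (intro funpow_theta_sum) auto
  then show ?thesis
    unfolding apply_op_def by (simp add: sum_distrib_left mult_ac sum.swap[of _ K])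
qed

lemma apply_op_add_arg:
  assumes "open S" "f holomorphic_on S" "g holomorphic_on S" "z \<in> S"
  shows "apply_op P (\<lambda>z. f z + c * g z) z = apply_op P f z + c * apply_op P g z"
proof -
  \<comment> \<open>A combination of two terms is a sum indexed by the Booleans.\<close>
  have "apply_op P (\<lambda>z. \<Sum>k\<in>UNIV. (if k then 1 else c) * (if k then f else g) z) z =
      (\<Sum>k\<in>UNIV. (if k then 1 else c) * apply_op P (if k then f else g) z)"
    by (rule apply_op_sum[OF assms(1) _ assms(4)]) (use assms in auto)
  then show ?thesis
    by (simp add: UNIV_bool add.commute)
qed

text \<open>From \<open>\<Theta> w = \<alpha> w\<close> the product rule gives
  \<open>(\<Theta> - \<alpha>)(w y) = w (\<Theta> y)\<close>: multiplication by \<open>w\<close>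
  intertwines \<Theta> with \<Theta> - \<alpha>, and it commutes with the coefficients on the
  left.\<close>

lemma apply_op_pcompose:
  assumes S: "open S" and w: "w holomorphic_on S" "\<And>z. z \<in> S \<Longrightarrow> theta w z = \<alpha> * w z" and z: "z \<in> S"
  shows "y holomorphic_on S \<Longrightarrow> (\<And>i. pole_le 0 z (coeff P i)) \<Longrightarrow>
    apply_op (pcompose P [:rf_const (- \<alpha>), 1:]) (\<lambda>z. w z * y z) z = w z * apply_op P y z"
proof (induction P arbitrary: y)
  case (pCons a P)
  let ?R = "pcompose P [:rf_const (- \<alpha>), 1:]" and ?u = "\<lambda>z. w z * y z"
  have a: "pole_le 0 z a" using pCons.prems(2)[of 0] by simp
  have P: "pole_le 0 z (coeff P i)" for i using pCons.prems(2)[of "Suc i"] by simp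
  have R: "pole_le 0 z (coeff ?R i)" for i
    by (rule coeff_filtration.pcompose_linear_mem[OF filtration_regular, simplified]) (rule P)
  have IH: "apply_op ?R (\<lambda>z. w z * v z) z = w z * apply_op P v z" if "v holomorphic_on S" for v
    using pCons.IH[OF that P] .
  have ty: "theta y holomorphic_on S"
    using theta_holomorphic S pCons.prems by blast
  have "theta ?u v = w v * theta y v + \<alpha> * ?u v" if "v \<in> S" for v
  proof -
    have "deriv ?u v = w v * deriv y v + deriv w v * y v"
      using that S w pCons.prems(1) by (intro complex_derivative_mult_at holomorphic_on_imp_analytic_at) auto
    then have "theta ?u v = w v * theta y v + theta w v * y v"
      by (simp add: theta_def algebra_simps)
    then show ?thesis using w(2)[OF that] by simp
  qed
  then have "apply_op ?R (theta ?u) z = apply_op ?R (\<lambda>v. w v * theta y v + \<alpha> * ?u v) z"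
    using S z by (intro apply_op_cong[of S]) auto
  also have "\<dots> = w z * apply_op P (theta y) z + \<alpha> * (w z * apply_op P y z)"
    using S z w ty pCons.prems(1) IH[OF ty] IH[OF pCons.prems(1)]
    by (subst apply_op_add_arg[of S]) (auto intro!: holomorphic_intros)
  finally have R_theta: "apply_op ?R (theta ?u) z = \<dots>" .
  have "pcompose (pCons a P) [:rf_const (- \<alpha>), 1:] = smult (rf_const (- \<alpha>)) ?R + pCons a ?R"
    by (simp add: pcompose_pCons)
  moreover have "pole_le 0 z (coeff (smult (rf_const (- \<alpha>)) ?R) i)" for i
    using R by (simp add: pole_le_mult_const)
  moreover have "pole_le 0 z (coeff (pCons a ?R) i)" for i
    using R a by (cases i) simp_all
  ultimately have "apply_op (pcompose (pCons a P) [:rf_const (- \<alpha>), 1:]) ?u z =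
      - \<alpha> * apply_op ?R ?u z + (rf_eval a z * ?u z + apply_op ?R (theta ?u) z)"
    using R by (simp add: apply_op_add apply_op_smult_const apply_op_pCons)
  then show ?case
    unfolding R_theta IH[OF pCons.prems(1)] by (simp add: apply_op_pCons algebra_simps)
qed simp

section \<open>Solutions of the shifted operator\<close>

lemma local_solutionI:
  "open S \<Longrightarrow> b \<in> S \<Longrightarrow> y holomorphic_on S \<Longrightarrow> (\<And>z. z \<in> S \<Longrightarrow> apply_op P y z = 0) \<Longrightarrow> local_solution P b y"
  unfolding local_solution_def using holomorphic_on_imp_analytic_at eventually_nhds by blast

lemma local_solutionE:
  assumes "local_solution P b y"
  obtains S where "open S" "b \<in> S" "y holomorphic_on S" "\<And>z. z \<in> S \<Longrightarrow> apply_op P y z = 0"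
proof -
  obtain S where S: "open S" "b \<in> S" "y holomorphic_on S"
    using assms unfolding local_solution_def analytic_at by blast
  obtain T where T: "open T" "b \<in> T" "\<And>z. z \<in> T \<Longrightarrow> apply_op P y z = 0"
    using assms unfolding local_solution_def eventually_nhds by blast
  show thesis
    using that[of "S \<inter> T"] S T by (auto intro: holomorphic_on_subset)
qed

lemma local_solution_shift:
  assumes P: "order4_operator P" and b: "b \<in> regular_locus P" and y: "local_solution P b y"
  shows "local_solution (shift \<alpha> P) b (\<lambda>z. powr_germ \<alpha> b z * y z)"
proof -
  obtain S where S: "open S" "b \<in> S" "y holomorphic_on S" "\<And>z. z \<in> S \<Longrightarrow> apply_op P y z = 0"
    using local_solutionE[OF y] by blast
  have nz: "b \<noteq> 0" using regular_locus_coeff[OF P b] by simp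
  \<comment> \<open>The three sets secure the solution, the branch of \<open>t^\<alpha>\<close> and
    the regularity of the coefficients, respectively.\<close>
  let ?T = "S \<inter> ball b (norm b) \<inter> regular_locus P"
  have T: "open ?T" "b \<in> ?T"
    using S nz b open_regular_locus by auto
  show ?thesis
  proof (rule local_solutionI[OF T])
    show "(\<lambda>z. powr_germ \<alpha> b z * y z) holomorphic_on ?T"
      using S(3) powr_germ_holomorphic(1)[OF nz, of \<alpha>]
      by (intro holomorphic_on_mult) (auto intro: holomorphic_on_subset)
    show "apply_op (shift \<alpha> P) (\<lambda>z. powr_germ \<alpha> b z * y z) z = 0" if z: "z \<in> ?T" for z
    proof -
      have "apply_op (shift \<alpha> P) (\<lambda>z. powr_germ \<alpha> b z * y z) z = powr_germ \<alpha> b z * apply_op P y z"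
        unfolding shift_def
      proof (rule apply_op_pcompose[OF T(1)])
        show "powr_germ \<alpha> b holomorphic_on ?T" "y holomorphic_on ?T"
          using S(3) powr_germ_holomorphic(1)[OF nz, of \<alpha>] by (auto intro: holomorphic_on_subset)
        show "theta (powr_germ \<alpha> b) v = \<alpha> * powr_germ \<alpha> b v" if "v \<in> ?T" for v
          using powr_germ_holomorphic(2)[OF nz] that by blast
        show "pole_le 0 z (coeff P i)" for i
          using regular_locus_coeff(2)[OF P] z by blast
      qed (rule z)
      then show ?thesis using S(4) z by simp
    qed
  qed
qed

definition twist :: "complex \<Rightarrow> complex \<Rightarrow> (4 \<Rightarrow> complex \<Rightarrow> complex) \<Rightarrow> 4 \<Rightarrow> complex \<Rightarrow> complex" where
  "twist \<alpha> b f = (\<lambda>i z. powr_germ \<alpha> b z * f i z)"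

lemma twist_uminus_twist [simp]: "twist (- \<alpha>) b (twist \<alpha> b f) = f"
  using powr_germ_uminus[of \<alpha> b] by (simp add: twist_def fun_eq_iff mult.assoc[symmetric])

text \<open>Multiplication by the branch of \<open>t^\<alpha>\<close> is undone by the branch for
  \<open>- \<alpha>\<close>. It is therefore a bijection between solution germs, and it leaves
  coordinates unchanged.\<close>

lemma solution_basis_shift:
  assumes P: "order4_operator P" and b: "b \<in> regular_locus P" and f: "solution_basis P b f"
  shows "solution_basis (shift \<alpha> P) b (twist \<alpha> b f)"
  unfolding solution_basis_def
proof (intro conjI allI impI)
  show "local_solution (shift \<alpha> P) b (twist \<alpha> b f i)" for i
    using f local_solution_shift[OF P b] unfolding solution_basis_def twist_def by blast
  fix y assume y: "local_solution (shift \<alpha> P) b y"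
  let ?y = "\<lambda>z. powr_germ (- \<alpha>) b z * y z"
  have "local_solution P b ?y"
    using local_solution_shift[OF order4_operator_shift[OF P], of b \<alpha> y "- \<alpha>"] y b
    by (simp add: regular_locus_shift[OF P])
  then have "\<exists>!c::complex^4. \<forall>\<^sub>F z in nhds b. ?y z = (\<Sum>i\<in>UNIV. c $ i * f i z)"
    using f unfolding solution_basis_def by blast
  moreover have "?y z = (\<Sum>i\<in>UNIV. c $ i * f i z) \<longleftrightarrow> y z = (\<Sum>i\<in>UNIV. c $ i * twist \<alpha> b f i z)"
    for z and c :: "complex^4"
  proof -
    have "(\<Sum>i\<in>UNIV. c $ i * twist \<alpha> b f i z) = powr_germ \<alpha> b z * (\<Sum>i\<in>UNIV. c $ i * f i z)"
      by (simp add: twist_def sum_distrib_left mult_ac)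
    moreover have "powr_germ (- \<alpha>) b z * y z = s \<longleftrightarrow> y z = powr_germ \<alpha> b z * s" for s
    proof
      assume s: "powr_germ (- \<alpha>) b z * y z = s"
      have "powr_germ \<alpha> b z * s = (powr_germ (- \<alpha>) b z * powr_germ \<alpha> b z) * y z"
        unfolding s[symmetric] by (simp only: mult_ac)
      then show "y z = powr_germ \<alpha> b z * s"
        by (simp add: powr_germ_uminus)
    next
      assume "y z = powr_germ \<alpha> b z * s"
      then show "powr_germ (- \<alpha>) b z * y z = s"
        by (simp add: powr_germ_uminus flip: mult.assoc)
    qed
    ultimately show ?thesis by simp
  qed
  ultimately show "\<exists>!c::complex^4. \<forall>\<^sub>F z in nhds b. y z = (\<Sum>i\<in>UNIV. c $ i * twist \<alpha> b f i z)"
    by simp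
qed

section \<open>Symplectic matrices\<close>

definition mscale :: "complex \<Rightarrow> complex^4^4 \<Rightarrow> complex^4^4" where
  "mscale c A = (\<chi> i j. c * A $ i $ j)"

lemma mscale_nth [simp]: "mscale c A $ i $ j = c * A $ i $ j"
  by (simp add: mscale_def)

lemma mscale_1 [simp]: "mscale 1 A = A"
  by (simp add: vec_eq_iff)

lemma mscale_m1: "mscale (- 1) A = - A"
  by (simp add: vec_eq_iff)

lemma mscale_mult_left: "mscale c A ** B = mscale c (A ** B)"
  and mscale_mult_right: "A ** mscale c B = mscale c (A ** B)"
  by (simp_all add: vec_eq_iff matrix_matrix_mult_def sum_distrib_left mult_ac)

lemma
  fixes A B :: "complex^4^4"
  shows matrix_uminus_left: "(- A) ** B = - (A ** B)"
    and matrix_uminus_right: "A ** (- B) = - (A ** B)"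
  using mscale_mult_left[of "- 1" A B] mscale_mult_right[of A "- 1" B]
  by (simp_all add: mscale_m1)

lemma trace_mscale: "trace (mscale c A) = c * trace A"
  by (simp add: trace_def sum_distrib_left)

lemma det_mscale: "det (mscale c A) = c ^ 4 * det A"
proof -
  have "mscale c A = (\<chi> i. c *s A $ i)"
    by (simp add: vec_eq_iff)
  then show ?thesis
    by (simp add: det_rows_mul)
qed

lemma matrix_inv_right: "invertible A \<Longrightarrow> A ** matrix_inv A = mat 1"
  and matrix_inv_left: "invertible A \<Longrightarrow> matrix_inv A ** A = mat 1"
  unfolding invertible_def matrix_inv_def by (metis (mono_tags, lifting) someI_ex)+

lemma trace_conj:
  fixes A C :: "complex^4^4"
  assumes "invertible C"
  shows "trace (C ** A ** matrix_inv C) = trace A"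
  by (metis assms matrix_inv_left matrix_mul_assoc matrix_mul_rid matrix_mul_lid trace_mul_sym)

lemma det_conj:
  fixes A C :: "complex^4^4"
  assumes "invertible C"
  shows "det (C ** A ** matrix_inv C) = det A"
proof -
  have "det C * det (matrix_inv C) = 1"
    using matrix_inv_right[OF assms] by (metis det_I det_mul)
  then show ?thesis by (simp add: det_mul algebra_simps)
qed

lemma conj_mult:
  fixes A B C :: "complex^4^4"
  assumes "invertible C"
  shows "(C ** A ** matrix_inv C) ** (C ** B ** matrix_inv C) = C ** (A ** B) ** matrix_inv C"
proof -
  have "(C ** A ** matrix_inv C) ** (C ** B ** matrix_inv C) =
      C ** A ** (matrix_inv C ** C) ** B ** matrix_inv C"
    by (simp only: matrix_mul_assoc)
  then show ?thesis
    using assms by (simp add: matrix_inv_left matrix_mul_assoc)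
qed

lemma conj_eq_iff:
  fixes A B C :: "complex^4^4"
  assumes "invertible C"
  shows "C ** A ** matrix_inv C = C ** B ** matrix_inv C \<longleftrightarrow> A = B"
proof -
  have "matrix_inv C ** (C ** M ** matrix_inv C) ** C = M" for M
  proof -
    have "matrix_inv C ** (C ** M ** matrix_inv C) ** C = (matrix_inv C ** C) ** M ** (matrix_inv C ** C)"
      by (simp only: matrix_mul_assoc)
    then show ?thesis
      using assms by (simp add: matrix_inv_left)
  qed
  then show ?thesis by metis
qed

lemma sympl_form_nth:
  "sympl_form $ i $ j =
    (if i = 1 \<and> j = 2 \<or> i = 3 \<and> j = 4 then 1 else if i = 2 \<and> j = 1 \<or> i = 4 \<and> j = 3 then - 1 else 0)"
  using exhaust_4[of i] exhaust_4[of j]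
  by (auto simp: sympl_form_def vector_def)

lemma sympl_form_square: "sympl_form ** sympl_form = - mat 1"
  by (simp add: vec_eq_iff forall_4 matrix_matrix_mult_def sum_4 sympl_form_nth mat_def)

lemma Sp4C_mult: "A \<in> Sp4C \<Longrightarrow> B \<in> Sp4C \<Longrightarrow> A ** B \<in> Sp4C"
  by (simp add: Sp4C_def matrix_transpose_mul) (metis matrix_mul_assoc)

lemma Sp4C_uminus: "A \<in> Sp4C \<Longrightarrow> - A \<in> Sp4C"
proof -
  have "transpose (- A) = - transpose A" by (simp add: vec_eq_iff transpose_def)
  then show "A \<in> Sp4C \<Longrightarrow> - A \<in> Sp4C"
    by (simp add: Sp4C_def matrix_uminus_left matrix_uminus_right)
qed

lemma Sp4C_one: "mat 1 \<in> Sp4C"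
  by (simp add: Sp4C_def transpose_mat)

text \<open>With J the form, J squared is -1, so the symplectic relation can be solved for the
  inverse of \<open>A\<close>. The formula also shows that inverses of integral symplectic matrices
  are integral.\<close>

lemma Sp4C_left_inverse:
  assumes "A \<in> Sp4C"
  shows "(- (sympl_form ** transpose A ** sympl_form)) ** A = mat 1"
proof -
  have "(sympl_form ** transpose A ** sympl_form) ** A = sympl_form ** (transpose A ** sympl_form ** A)"
    by (simp add: matrix_mul_assoc)
  also have "\<dots> = - mat 1"
    using assms by (simp add: Sp4C_def sympl_form_square)
  finally show ?thesis
    by (simp add: matrix_uminus_left)
qed

lemma Sp4C_det:
  assumes "A \<in> Sp4C"
  shows "det A ^ 2 = 1"
proof -
  have "det sympl_form * det sympl_form = det (- mat 1 :: complex^4^4)"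
    by (simp flip: sympl_form_square det_mul)
  also have "\<dots> = 1"
    using det_mscale[of "- 1" "mat 1"] by (simp add: mscale_m1)
  finally have nz: "det sympl_form \<noteq> 0" by auto
  have "det (transpose A ** sympl_form ** A) = det sympl_form"
    using assms by (simp add: Sp4C_def)
  then have "det sympl_form * det A ^ 2 = det sympl_form"
    by (simp add: det_mul power2_eq_square algebra_simps)
  then show ?thesis using nz by simp
qed

lemma Sp4Z_simps [simp]: "carrier Sp4Z = {A \<in> Sp4C. \<forall>i j. A $ i $ j \<in> \<int>}"
  "mult Sp4Z = (**)" "one Sp4Z = mat 1"
  by (simp_all add: Sp4Z_def)

lemma integral_matrix_mult:
  fixes A B :: "complex^4^4"
  assumes "\<forall>i j. A $ i $ j \<in> \<int>" "\<forall>i j. B $ i $ j \<in> \<int>"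
  shows "\<forall>i j. (A ** B) $ i $ j \<in> \<int>"
  using assms by (auto simp: matrix_matrix_mult_def intro!: Ints_sum Ints_mult)

lemma group_Sp4Z: "group Sp4Z"
proof (rule groupI)
  show "x \<otimes>\<^bsub>Sp4Z\<^esub> y \<in> carrier Sp4Z" if "x \<in> carrier Sp4Z" "y \<in> carrier Sp4Z" for x y
    using that integral_matrix_mult[of x y] by (simp add: Sp4C_mult)
  show "\<exists>y\<in>carrier Sp4Z. y \<otimes>\<^bsub>Sp4Z\<^esub> x = \<one>\<^bsub>Sp4Z\<^esub>" if "x \<in> carrier Sp4Z" for x
  proof -
    let ?y = "- (sympl_form ** transpose x ** sympl_form)"
    have 1: "?y ** x = mat 1" using that Sp4C_left_inverse by simp
    then have 2: "x ** ?y = mat 1" using matrix_left_right_inverse by blast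
    have x: "transpose x ** sympl_form ** x = sympl_form" using that by (simp add: Sp4C_def)
    have "?y \<in> Sp4C"
    proof -
      \<comment> \<open>Replacing the form by its pullback under \<open>x\<close> makes the products
        \<open>x ** ?y = mat 1\<close> appear on both sides.\<close>
      have "transpose ?y ** sympl_form ** ?y =
         transpose ?y ** (transpose x ** sympl_form ** x) ** ?y"
        by (simp add: x)
      also have "\<dots> = transpose (x ** ?y) ** sympl_form ** (x ** ?y)"
        by (simp only: matrix_transpose_mul matrix_mul_assoc)
      finally show ?thesis by (simp add: 2 Sp4C_def transpose_mat)
    qed
    moreover have "?y $ i $ j \<in> \<int>" for i j
    proof -
      have "\<forall>i j. (sympl_form ** transpose x ** sympl_form) $ i $ j \<in> \<int>"
        using that by (intro integral_matrix_mult) (auto simp: sympl_form_nth transpose_def)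
      then show ?thesis by simp
    qed
    ultimately show ?thesis using 1 by auto
  qed
  show "\<one>\<^bsub>Sp4Z\<^esub> \<in> carrier Sp4Z"
    using Sp4C_one by (simp, simp add: mat_def)
qed (auto simp: matrix_mul_assoc)

section \<open>Polynomial functions and Zariski density\<close>

lemma polynomial_fun_uminus_arg: "polynomial_fun p \<Longrightarrow> polynomial_fun (\<lambda>A. p (- A))"
proof (induction rule: polynomial_fun.induct)
  case (entry i j)
  have "polynomial_fun (\<lambda>A. (- 1) * A $ i $ j)"
    by (intro polynomial_fun.intros)
  then show ?case by simp
qed (auto intro: polynomial_fun.intros)

lemma polynomial_fun_holomorphic:
  fixes \<Phi> :: "complex \<Rightarrow> complex^4^4"
  assumes "polynomial_fun p" "\<And>i j. (\<lambda>z. \<Phi> z $ i $ j) holomorphic_on S"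
  shows "(\<lambda>z. p (\<Phi> z)) holomorphic_on S"
  using assms(1) by induction (auto intro!: holomorphic_intros assms(2))

text \<open>The diagonal maximal torus of Sp(4,C). It supplies both holomorphic curves in the group
  and test matrices whose trace is known.\<close>

definition torus :: "complex \<Rightarrow> complex \<Rightarrow> complex^4^4" where
  "torus x y = (\<chi> i j. if i = j then if i = 1 then x else if i = 2 then inverse x
     else if i = 3 then y else inverse y else 0)"

lemma torus_Sp4C: "x \<noteq> 0 \<Longrightarrow> y \<noteq> 0 \<Longrightarrow> torus x y \<in> Sp4C"
  by (simp add: Sp4C_def vec_eq_iff forall_4 matrix_matrix_mult_def sum_4 sympl_form_nth torus_def transpose_def)

text \<open>
  The path \<open>A * diag(e\<^sup>z, e\<^sup>-\<^sup>z, e\<^sup>z, e\<^sup>-\<^sup>z)\<close> in \<open>Sp(4,\<complex>)\<close> runs from \<open>A\<close> to \<open>- A\<close> as \<open>z\<close> runs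
  from \<open>0\<close> to \<open>\<pi>\<i>\<close>; with \<open>h\<close> the restriction of \<open>p\<close> to it, \<open>h z * h (z + \<pi>\<i>)\<close> vanishes identically.
\<close>

lemma polynomial_fun_vanishes_symmetric:
  assumes p: "polynomial_fun p" and van: "\<And>A. A \<in> Sp4C \<Longrightarrow> p A * p (- A) = 0" and A: "A \<in> Sp4C"
  shows "p A = 0"
proof (rule ccontr)
  assume nz: "p A \<noteq> 0"
  define h where "h z = p (A ** torus (exp z) (exp z))" for z
  have hol: "h holomorphic_on UNIV"
    unfolding h_def[abs_def]
  proof (rule polynomial_fun_holomorphic[OF p])
    show "(\<lambda>z. (A ** torus (exp z) (exp z)) $ i $ j) holomorphic_on UNIV" for i j
      using exhaust_4[of j]
      by (auto simp: matrix_matrix_mult_def sum_4 torus_def intro!: holomorphic_intros simp flip: exp_minus)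
  qed
  have "torus 1 1 = mat 1"
    by (simp add: vec_eq_iff torus_def mat_def)
  then have h0: "h 0 \<noteq> 0"
    using nz by (simp add: h_def)
  have prod: "h z * h (z + of_real pi * \<i>) = 0" for z
  proof -
    have "torus (exp (z + of_real pi * \<i>)) (exp (z + of_real pi * \<i>)) = - torus (exp z) (exp z)"
      by (simp add: vec_eq_iff torus_def exp_add)
    then show ?thesis
      unfolding h_def using van[OF Sp4C_mult[OF A torus_Sp4C]] by (simp add: matrix_uminus_right)
  qed
  have "open (h -` (- {0}))"
    using holomorphic_on_imp_continuous_on[OF hol] open_vimage[of "- {0}" h]
    by (simp add: continuous_on_eq_continuous_at open_Compl)
  then have ev: "open {z. h z \<noteq> 0}"
    by (simp add: vimage_def)
  have "h (z + of_real pi * \<i>) = 0" for z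
  proof (rule analytic_continuation_open[of "{z. h z \<noteq> 0}" UNIV
        "\<lambda>z. h (z + of_real pi * \<i>)" "\<lambda>_. 0"])
    show "(\<lambda>z. h (z + of_real pi * \<i>)) holomorphic_on UNIV"
      using holomorphic_on_compose_gen[of "\<lambda>z. z + of_real pi * \<i>" UNIV h UNIV] hol
      by (simp add: o_def holomorphic_intros)
  qed (use ev h0 prod in auto)
  from this[of "- of_real pi * \<i>"] h0 show False by simp
qed

text \<open>Explicit symplectic \<open>X\<close> with \<open>trace X \<noteq> 0\<close> isolate the entries of the first column of \<open>N\<close>.\<close>

lemma trace_product_zero_imp_column_zero:
  fixes N :: "complex^4^4"
  assumes "\<And>X. X \<in> Sp4C \<Longrightarrow> trace X * trace (X ** N) = 0"
  shows "N $ i $ 1 = 0"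
proof -
  have *: "trace (X ** N) = 0" if "X \<in> Sp4C" "trace X \<noteq> 0" for X
    using assms[OF that(1)] that(2) by simp
  have t: "x * N $ 1 $ 1 + inverse x * N $ 2 $ 2 + N $ 3 $ 3 + N $ 4 $ 4 = 0"
    if "x \<noteq> 0" "x + inverse x + 2 \<noteq> 0" for x
  proof -
    have "trace (torus x 1) = x + inverse x + 2"
      by (simp add: trace_def sum_4 torus_def)
    moreover have "trace (torus x 1 ** N) = x * N $ 1 $ 1 + inverse x * N $ 2 $ 2 + N $ 3 $ 3 + N $ 4 $ 4"
      by (simp add: trace_def sum_4 torus_def matrix_matrix_mult_def)
    ultimately show ?thesis
      using *[OF torus_Sp4C[of x 1]] that by simp
  qed
  let ?t = "\<lambda>x. x * N $ 1 $ 1 + inverse x * N $ 2 $ 2 + N $ 3 $ 3 + N $ 4 $ 4"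
  have t': "?t 1 = 0" "?t 2 = 0" "?t 3 = 0"
    by (rule t; simp)+
  \<comment> \<open>The weights 1/2, -2, 3/2 at x = 1, 2, 3 annihilate the constant function and
    \<open>1/x\<close>, and give 1 on \<open>x\<close>.\<close>
  have "N $ 1 $ 1 = ?t 1 / 2 - 2 * ?t 2 + 3 / 2 * ?t 3"
    by (simp add: field_simps)
  also have "\<dots> = 0"
    by (simp only: t') simp
  finally have N11: "N $ 1 $ 1 = 0" .
  \<comment> \<open>Off-diagonal entries added to \<open>torus c 1\<close>. With
    \<open>d = inverse c\<close> the entries \<open>- b * d\<close> and \<open>e * d\<close> keep
    the second column orthogonal to the third and fourth; the diagonal, and so the trace, is that of
    the torus element.\<close>
  define U where "U = (\<lambda>a b c d e. (\<chi> i j. if i = j then torus c 1 $ i $ j else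
    if i = 1 \<and> j = 2 then a else if i = 1 \<and> j = 3 then b else if i = 4 \<and> j = 2 then - b * d
    else if i = 1 \<and> j = 4 then e else if i = 3 \<and> j = 2 then e * d else 0) :: complex^4^4)"
  have U: "U a b c (inverse c) e \<in> Sp4C" if "c \<noteq> 0" "b = 0 \<or> e = 0" for a b c e
    using that unfolding U_def Sp4C_def
    by (auto simp: vec_eq_iff forall_4 matrix_matrix_mult_def sum_4 sympl_form_nth torus_def transpose_def)
  have trU: "trace (U a b c d e) = c + inverse c + 2" for a b c d e
    by (simp add: trace_def sum_4 U_def torus_def)
  have trUN: "trace (U a b c d e ** N) = trace (torus c 1 ** N) + a * N $ 2 $ 1 +
     b * N $ 3 $ 1 - b * d * N $ 2 $ 4 + e * N $ 4 $ 1 + e * d * N $ 2 $ 3" for a b c d e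
    by (simp add: trace_def sum_4 U_def torus_def matrix_matrix_mult_def algebra_simps)
  have u: "a * N $ 2 $ 1 + b * N $ 3 $ 1 - b * inverse c * N $ 2 $ 4 + e * N $ 4 $ 1 + e * inverse c * N $ 2 $ 3 = 0"
    if "c \<noteq> 0" "c + inverse c + 2 \<noteq> 0" "b = 0 \<or> e = 0" for a b c e
  proof -
    have "trace (torus c 1) = c + inverse c + 2"
      by (simp add: trace_def sum_4 torus_def)
    then have "trace (torus c 1 ** N) = 0"
      using *[OF torus_Sp4C[of c 1]] that by simp
    moreover have "trace (U a b c (inverse c) e ** N) = 0"
      using *[OF U[of c b e a]] that by (simp add: trU)
    ultimately show ?thesis
      by (simp add: trUN)
  qed
  have N21: "N $ 2 $ 1 = 0"
    using u[of 1 0 0 1] by simp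
  \<comment> \<open>Each off-diagonal parameter brings in an unwanted second entry of
    \<open>N\<close>, weighted by \<open>inverse c\<close>. The values \<open>c = 1\<close> and
    \<open>c = 2\<close> separate the two.\<close>
  have u3: "N $ 3 $ 1 - inverse 2 * N $ 2 $ 4 = 0" "N $ 3 $ 1 - N $ 2 $ 4 = 0"
    using u[of 1 1 0 0] u[of 2 1 0 0] by simp_all
  have "N $ 3 $ 1 = 2 * (N $ 3 $ 1 - inverse 2 * N $ 2 $ 4) - (N $ 3 $ 1 - N $ 2 $ 4)"
    by simp
  also have "\<dots> = 0" by (simp only: u3) simp
  finally have N31: "N $ 3 $ 1 = 0" .
  have u4: "N $ 4 $ 1 + inverse 2 * N $ 2 $ 3 = 0" "N $ 4 $ 1 + N $ 2 $ 3 = 0"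
    using u[of 1 0 1 0] u[of 2 0 1 0] by simp_all
  have "N $ 4 $ 1 = 2 * (N $ 4 $ 1 + inverse 2 * N $ 2 $ 3) - (N $ 4 $ 1 + N $ 2 $ 3)"
    by simp
  also have "\<dots> = 0" by (simp only: u4) simp
  finally have N41: "N $ 4 $ 1 = 0" .
  show ?thesis
    using exhaust_4[of i] N11 N21 N31 N41 by auto
qed

text \<open>Otherwise the first column of \<open>N\<close> would vanish, although its pairing with
  the second column is an entry \<open>- 1\<close> of the form.\<close>

lemma exists_nonzero_trace_product:
  assumes "N \<in> Sp4C"
  obtains X where "X \<in> Sp4C" "trace X \<noteq> 0" "trace (X ** N) \<noteq> 0"
proof (rule ccontr)
  assume "\<not> thesis"
  then have "N $ i $ 1 = 0" for i
    using that by (intro trace_product_zero_imp_column_zero) auto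
  then have "(transpose N ** sympl_form ** N) $ 2 $ 1 = 0"
    by (simp add: matrix_matrix_mult_def)
  moreover have "(transpose N ** sympl_form ** N) $ 2 $ 1 = - 1"
    using assms by (simp add: Sp4C_def sympl_form_nth)
  ultimately show False by simp
qed

lemma polynomial_fun_sum:
  "finite I \<Longrightarrow> (\<And>i. i \<in> I \<Longrightarrow> polynomial_fun (f i)) \<Longrightarrow> polynomial_fun (\<lambda>A. \<Sum>i\<in>I. f i A)"
  by (induction I rule: finite_induct) (auto intro: polynomial_fun.intros)

lemma polynomial_fun_trace_mult: "polynomial_fun (\<lambda>A. trace (A ** N))"
  unfolding trace_def matrix_matrix_mult_def
  by (simp, intro polynomial_fun_sum polynomial_fun.intros) auto

lemma zariski_closure_vanish:
  "A \<in> zariski_closure X \<Longrightarrow> polynomial_fun p \<Longrightarrow> (\<And>B. B \<in> X \<Longrightarrow> p B = 0) \<Longrightarrow> p A = 0"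
  by (simp add: zariski_closure_def)

text \<open>If \<open>p\<close> vanishes on \<open>H\<close>, then \<open>p A * p (- A)\<close>
  vanishes on \<open>G\<close>, whatever sign each element takes, and by density on all of Sp(4,C).
  The symmetric vanishing lemma then removes the second factor.\<close>

lemma zariski_dense_up_to_sign:
  assumes "Sp4C \<subseteq> zariski_closure G" "\<And>A. A \<in> G \<Longrightarrow> A \<in> H \<or> - A \<in> H"
  shows "Sp4C \<subseteq> zariski_closure H"
proof
  fix A assume A: "A \<in> Sp4C"
  have "p A = 0" if p: "polynomial_fun p" "\<forall>B\<in>H. p B = 0" for p
  proof (rule polynomial_fun_vanishes_symmetric[OF p(1) _ A])
    fix B assume B: "B \<in> Sp4C"
    have "polynomial_fun (\<lambda>A. p A * p (- A))"
      using p polynomial_fun_uminus_arg by (auto intro: polynomial_fun.intros)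
    moreover have "p C * p (- C) = 0" if "C \<in> G" for C
      using assms(2)[OF that] p(2) by auto
    ultimately show "p B * p (- B) = 0"
      using zariski_closure_vanish[of B G "\<lambda>A. p A * p (- A)"] assms(1) B by blast
  qed
  then show "A \<in> zariski_closure H"
    by (simp add: zariski_closure_def)
qed

text \<open>A coset \<open>K r\<close> is contained in the union of \<open>H r\<close> and
  \<open>H (- r)\<close>, so there are at most twice as many cosets of \<open>H\<close> as of
  \<open>K\<close>.\<close>

lemma finite_rcosets_up_to_sign:
  assumes K: "subgroup K Sp4Z" and H: "subgroup H Sp4Z"
    and sign: "\<And>A. A \<in> K \<Longrightarrow> A \<in> H \<or> - A \<in> H" and fin: "finite (rcosets\<^bsub>Sp4Z\<^esub> K)"
  shows "finite (rcosets\<^bsub>Sp4Z\<^esub> H)"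
proof -
  interpret group Sp4Z by (rule group_Sp4Z)
  define rep where "rep = (\<lambda>c. SOME r. r \<in> carrier Sp4Z \<and> c = K #>\<^bsub>Sp4Z\<^esub> r)"
  have "rcosets\<^bsub>Sp4Z\<^esub> H \<subseteq> (\<Union>c\<in>rcosets\<^bsub>Sp4Z\<^esub> K. {H #>\<^bsub>Sp4Z\<^esub> rep c, H #>\<^bsub>Sp4Z\<^esub> (- rep c)})"
  proof
    fix d assume "d \<in> rcosets\<^bsub>Sp4Z\<^esub> H"
    then obtain x where x: "x \<in> carrier Sp4Z" "d = H #>\<^bsub>Sp4Z\<^esub> x"
      unfolding RCOSETS_def by blast
    let ?c = "K #>\<^bsub>Sp4Z\<^esub> x"
    have "\<exists>r. r \<in> carrier Sp4Z \<and> ?c = K #>\<^bsub>Sp4Z\<^esub> r" using x by blast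
    then have r: "rep ?c \<in> carrier Sp4Z \<and> ?c = K #>\<^bsub>Sp4Z\<^esub> rep ?c"
      unfolding rep_def by (rule someI_ex)
    have "x \<in> K #>\<^bsub>Sp4Z\<^esub> rep ?c"
      using rcos_self[OF x(1) K] r by simp
    then obtain k where k: "k \<in> K" "x = k ** rep ?c"
      unfolding r_coset_def by auto
    have nrep: "- rep ?c \<in> carrier Sp4Z"
      using r by (simp add: Sp4C_uminus)
    have "d = H #>\<^bsub>Sp4Z\<^esub> rep ?c \<or> d = H #>\<^bsub>Sp4Z\<^esub> (- rep ?c)"
      using sign[OF k(1)]
    proof
      assume "k \<in> H"
      then have "x \<in> H #>\<^bsub>Sp4Z\<^esub> rep ?c" using k unfolding r_coset_def by auto
      then show ?thesis using repr_independence[OF _ conjunct1[OF r] H] x by auto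
    next
      assume "- k \<in> H"
      moreover have "x = (- k) ** (- rep ?c)"
        using k by (simp add: matrix_uminus_left matrix_uminus_right)
      ultimately have "x \<in> H #>\<^bsub>Sp4Z\<^esub> (- rep ?c)" unfolding r_coset_def by auto
      then show ?thesis using repr_independence[OF _ nrep H] x by auto
    qed
    moreover have "?c \<in> rcosets\<^bsub>Sp4Z\<^esub> K"
      using x unfolding RCOSETS_def by blast
    ultimately show "d \<in> (\<Union>c\<in>rcosets\<^bsub>Sp4Z\<^esub> K. {H #>\<^bsub>Sp4Z\<^esub> rep c, H #>\<^bsub>Sp4Z\<^esub> (- rep c)})"
      by blast
  qed
  moreover have "finite \<dots>" using fin by auto
  ultimately show ?thesis by (rule finite_subset)
qed

section \<open>Monodromy of the shifted operator\<close>

lemma lincomb_lincomb: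
  fixes M :: "complex^4^4"
  shows "(\<Sum>j\<in>UNIV. c j * (\<Sum>i\<in>UNIV. M $ i $ j * f i z)) = (\<Sum>i\<in>UNIV. (\<Sum>j\<in>UNIV. M $ i $ j * c j) * f i z)"
  unfolding sum_distrib_left sum_distrib_right
  by (subst sum.swap) (simp add: mult_ac)

text \<open>Keeps the loop that \<open>monodromy_group\<close> forgets: the scalar produced by the
  shift depends on the loop and not on the matrix alone.\<close>

definition monodromy_along ::
    "diffop \<Rightarrow> complex \<Rightarrow> (4 \<Rightarrow> complex \<Rightarrow> complex) \<Rightarrow> (real \<Rightarrow> complex) \<Rightarrow> complex^4^4 \<Rightarrow> bool" where
  "monodromy_along P b f \<gamma> M \<longleftrightarrow>
     path \<gamma> \<and> path_image \<gamma> \<subseteq> regular_locus P \<and> pathstart \<gamma> = b \<and> pathfinish \<gamma> = b \<and>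
     (\<forall>j. continues_along \<gamma> (f j) (\<lambda>z. \<Sum>i\<in>UNIV. M $ i $ j * f i z))"

lemma monodromy_group_iff: "M \<in> monodromy_group P b f \<longleftrightarrow> (\<exists>\<gamma>. monodromy_along P b f \<gamma> M)"
  by (simp add: monodromy_group_def monodromy_along_def)

lemma continues_along_lincomb:
  fixes c :: "'i :: finite \<Rightarrow> complex"
  assumes "\<And>i. continues_along \<gamma> (f i) (g i)"
  shows "continues_along \<gamma> (\<lambda>z. \<Sum>i\<in>UNIV. c i * f i z) (\<lambda>z. \<Sum>i\<in>UNIV. c i * g i z)"
  using assms unfolding continues_along_iff by (intro cont_on_sum cont_on_cmult)

lemma monodromy_along_continues_lincomb:
  fixes M :: "complex^4^4"
  assumes "monodromy_along P b f \<gamma> M"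
  shows "continues_along \<gamma> (\<lambda>z. \<Sum>j\<in>UNIV. c j * f j z)
    (\<lambda>z. \<Sum>i\<in>UNIV. (\<Sum>j\<in>UNIV. M $ i $ j * c j) * f i z)"
  using continues_along_lincomb[of \<gamma> f "\<lambda>j z. \<Sum>i\<in>UNIV. M $ i $ j * f i z" c] assms
  unfolding monodromy_along_def lincomb_lincomb by blast

text \<open>Columns hold images of basis elements, so the matrices compose as linear maps and the
  path followed first contributes the right-hand factor.\<close>

lemma monodromy_along_join:
  assumes M: "monodromy_along P b f \<gamma> M" and N: "monodromy_along P b f \<delta> N"
  shows "monodromy_along P b f (\<gamma> +++ \<delta>) (N ** M)"
proof -
  have "continues_along (\<gamma> +++ \<delta>) (f j) (\<lambda>z. \<Sum>i\<in>UNIV. (N ** M) $ i $ j * f i z)" for j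
  proof (rule continues_along_join)
    show "continues_along \<gamma> (f j) (\<lambda>z. \<Sum>i\<in>UNIV. M $ i $ j * f i z)"
      using M by (simp add: monodromy_along_def)
    show "continues_along \<delta> (\<lambda>z. \<Sum>i\<in>UNIV. M $ i $ j * f i z) (\<lambda>z. \<Sum>i\<in>UNIV. (N ** M) $ i $ j * f i z)"
      using monodromy_along_continues_lincomb[OF N, of "\<lambda>i. M $ i $ j"]
      by (simp add: matrix_matrix_mult_def)
  qed (use M N in \<open>auto simp: monodromy_along_def\<close>)
  then show ?thesis
    using M N unfolding monodromy_along_def by (auto simp: path_image_join)
qed

text \<open>Column \<open>k\<close> of \<open>N\<close> gives a combination of the basis that
  continues along \<open>\<gamma>\<close> to \<open>f k\<close>; read backwards, this is the
  continuation of \<open>f k\<close>.\<close>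

lemma monodromy_along_reversepath:
  assumes M: "monodromy_along P b f \<gamma> M" and N: "M ** N = mat 1"
  shows "monodromy_along P b f (reversepath \<gamma>) N"
proof -
  have "continues_along (reversepath \<gamma>) (f k) (\<lambda>z. \<Sum>j\<in>UNIV. N $ j $ k * f j z)" for k
  proof -
    have "(\<Sum>j\<in>UNIV. M $ i $ j * N $ j $ k) = (if i = k then 1 else 0)" for i
      using arg_cong[OF N, of "\<lambda>A. A $ i $ k"] by (simp add: matrix_matrix_mult_def mat_def)
    then have "(\<Sum>i\<in>UNIV. (\<Sum>j\<in>UNIV. M $ i $ j * N $ j $ k) * f i z) = f k z" for z
      by (simp add: if_distrib[of "\<lambda>x. x * _"] cong: if_cong)
    then have "continues_along \<gamma> (\<lambda>z. \<Sum>j\<in>UNIV. N $ j $ k * f j z) (f k)"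
      using monodromy_along_continues_lincomb[OF M, of "\<lambda>j. N $ j $ k"] by simp
    then show ?thesis by (rule continues_along_reversepath)
  qed
  then show ?thesis
    using M unfolding monodromy_along_def by simp
qed

lemma monodromy_along_constant:
  assumes "b \<in> regular_locus P" "\<And>i. f i analytic_on {b}"
  shows "monodromy_along P b f (\<lambda>_. b) (mat 1)"
proof -
  have "(\<Sum>i\<in>UNIV. mat 1 $ i $ j * f i z) = f j z" for j z
    by (simp add: mat_def if_distrib[of "\<lambda>x. x * _"] cong: if_cong)
  moreover have "continues_along (\<lambda>_. b) (f j) (f j)" for j
    unfolding continues_along_iff using assms(2) by (intro cont_on_const)
  ultimately show ?thesis
    using assms(1) by (auto simp: monodromy_along_def path_def path_image_def pathstart_def pathfinish_def)
qed

lemma matrix_mult_mem_monodromy_group: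
  "M \<in> monodromy_group P b f \<Longrightarrow> N \<in> monodromy_group P b f \<Longrightarrow> M ** N \<in> monodromy_group P b f"
  using monodromy_along_join unfolding monodromy_group_iff by blast

lemma right_inverse_mem_monodromy_group:
  "M \<in> monodromy_group P b f \<Longrightarrow> M ** N = mat 1 \<Longrightarrow> N \<in> monodromy_group P b f"
  using monodromy_along_reversepath unfolding monodromy_group_iff by blast

lemma mat_1_mem_monodromy_group:
  assumes "b \<in> regular_locus P" "solution_basis P b f"
  shows "mat 1 \<in> monodromy_group P b f"
  using monodromy_along_constant[OF assms(1)] assms(2)
  unfolding monodromy_group_iff solution_basis_def local_solution_def by blast

section \<open>The scalar factors caused by the shift\<close>

abbreviation multiplier :: "complex \<Rightarrow> complex" where
  "multiplier \<alpha> \<equiv> exp (2 * of_real pi * \<i> * \<alpha>)"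

lemma multiplier_uminus: "multiplier (- \<alpha>) powi n = multiplier \<alpha> powi (- n)"
  by (simp add: exp_power_int)

lemma multiplier_eq_sign:
  assumes "2 * \<alpha> \<in> \<int>"
  shows "multiplier \<alpha> = 1 \<or> multiplier \<alpha> = - 1"
proof -
  obtain m :: int where m: "2 * \<alpha> = of_int m"
    using assms by (auto elim: Ints_cases)
  have "multiplier \<alpha> ^ 2 = exp ((2 * of_int m * of_real pi) * \<i>)"
    unfolding m[symmetric] by (simp add: power2_eq_square algebra_simps flip: exp_add)
  also have "\<dots> = 1"
    by (subst exp_eq_1) auto
  finally show ?thesis
    by (simp add: power2_eq_1_iff)
qed

lemma monodromy_along_shift:
  assumes P: "order4_operator P" and M: "monodromy_along P b f \<gamma> M"
    and w: "continues_along \<gamma> (powr_germ \<alpha> b) (\<lambda>z. c * powr_germ \<alpha> b z)"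
  shows "monodromy_along (shift \<alpha> P) b (twist \<alpha> b f) \<gamma> (mscale c M)"
proof -
  have "continues_along \<gamma> (twist \<alpha> b f j) (\<lambda>z. \<Sum>i\<in>UNIV. mscale c M $ i $ j * twist \<alpha> b f i z)" for j
  proof -
    have "continues_along \<gamma> (\<lambda>z. powr_germ \<alpha> b z * f j z)
        (\<lambda>z. (c * powr_germ \<alpha> b z) * (\<Sum>i\<in>UNIV. M $ i $ j * f i z))"
      using w M unfolding monodromy_along_def continues_along_iff by (intro cont_on_mult) auto
    then show ?thesis
      by (simp add: twist_def sum_distrib_left mult_ac)
  qed
  then show ?thesis
    using M by (simp add: monodromy_along_def regular_locus_shift[OF P])
qed

lemma monodromy_group_shift:
  assumes P: "order4_operator P" and M: "M \<in> monodromy_group P b f"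
  shows "\<exists>n :: int. mscale (multiplier \<alpha> powi n) M \<in> monodromy_group (shift \<alpha> P) b (twist \<alpha> b f)"
proof -
  obtain \<gamma> where \<gamma>: "monodromy_along P b f \<gamma> M"
    using M monodromy_group_iff by blast
  have "0 \<notin> path_image \<gamma>"
    using \<gamma> unfolding monodromy_along_def regular_locus_def by blast
  then obtain n :: int where
    "\<And>\<alpha>. continues_along \<gamma> (powr_germ \<alpha> b) (\<lambda>z. multiplier \<alpha> powi n * powr_germ \<alpha> b z)"
    using powr_germ_continues_along_loop[of \<gamma> b] \<gamma> unfolding monodromy_along_def by blast
  then show ?thesis
    using monodromy_along_shift[OF P \<gamma>] unfolding monodromy_group_iff by blast
qed

lemma monodromy_group_unshift:
  assumes P: "order4_operator P" and M: "M \<in> monodromy_group (shift \<alpha> P) b (twist \<alpha> b f)"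
  shows "\<exists>n :: int. mscale (multiplier \<alpha> powi n) M \<in> monodromy_group P b f"
  using monodromy_group_shift[OF order4_operator_shift[OF P] M, of "- \<alpha>"]
  unfolding multiplier_uminus by auto

section \<open>Shifts by half-integers\<close>

lemma conj_unconj:
  fixes A C :: "complex^4^4"
  assumes "invertible C"
  shows "C ** (matrix_inv C ** A ** C) ** matrix_inv C = A"
proof -
  have "C ** (matrix_inv C ** A ** C) ** matrix_inv C = (C ** matrix_inv C) ** A ** (C ** matrix_inv C)"
    by (simp only: matrix_mul_assoc)
  then show ?thesis
    using assms by (simp add: matrix_inv_right)
qed

lemma conj_uminus:
  fixes A C :: "complex^4^4"
  shows "C ** (- A) ** matrix_inv C = - (C ** A ** matrix_inv C)"
  by (simp add: matrix_uminus_left matrix_uminus_right)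

text \<open>The same \<open>C\<close> serves for both groups, since the twisted basis keeps
  coordinates and all scalars are signs.\<close>

context
  fixes P :: diffop and \<alpha> b :: complex and f :: "4 \<Rightarrow> complex \<Rightarrow> complex" and C :: "complex^4^4"
    and G H :: "(complex^4^4) set"
  assumes P: "order4_operator P" and b: "b \<in> regular_locus P" and f: "solution_basis P b f"
    and half: "2 * \<alpha> \<in> \<int>" and C: "sympl_identification C (monodromy_group P b f)"
  defines "G \<equiv> conj_by C (monodromy_group P b f)"
    and "H \<equiv> conj_by C (monodromy_group (shift \<alpha> P) b (twist \<alpha> b f))"
begin

lemma multiplier_power_sign: "multiplier \<alpha> powi n = 1 \<or> multiplier \<alpha> powi n = - 1"
  using multiplier_eq_sign[OF half] by (cases "even n") (auto simp: power_int_minus_one_minus)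

lemma shift_up_to_sign: "A \<in> G \<Longrightarrow> A \<in> H \<or> - A \<in> H"
proof -
  assume "A \<in> G"
  then obtain M where M: "M \<in> monodromy_group P b f" "A = C ** M ** matrix_inv C"
    unfolding G_def conj_by_def by blast
  then obtain n where n: "mscale (multiplier \<alpha> powi n) M \<in> monodromy_group (shift \<alpha> P) b (twist \<alpha> b f)"
    using monodromy_group_shift[OF P] by blast
  show ?thesis
    using multiplier_power_sign[of n] n M(2) unfolding H_def conj_by_def
    by (auto simp: mscale_m1 conj_uminus[symmetric])
qed

lemma unshift_up_to_sign: "A \<in> H \<Longrightarrow> A \<in> G \<or> - A \<in> G"
proof -
  assume "A \<in> H"
  then obtain M where M: "M \<in> monodromy_group (shift \<alpha> P) b (twist \<alpha> b f)" "A = C ** M ** matrix_inv C"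
    unfolding H_def conj_by_def by blast
  then obtain n where n: "mscale (multiplier \<alpha> powi n) M \<in> monodromy_group P b f"
    using monodromy_group_unshift[OF P] by blast
  show ?thesis
    using multiplier_power_sign[of n] n M(2) unfolding G_def conj_by_def
    by (auto simp: mscale_m1 conj_uminus[symmetric])
qed

lemma invertible_C: "invertible C" and subgroup_G: "subgroup G Sp4Z" and dense_G: "Sp4C \<subseteq> zariski_closure G"
  using C by (simp_all add: sympl_identification_def G_def)

text \<open>Signs affect neither integrality nor the symplectic relation, so \<open>H\<close> lies
  in Sp(4,Z). Agreement with \<open>G\<close> up to sign does not give closure; that comes from
  joining and reversing loops.\<close>

lemma subgroup_H: "subgroup H Sp4Z"
proof
  interpret group Sp4Z by (rule group_Sp4Z)
  show sub: "H \<subseteq> carrier Sp4Z"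
  proof
    fix A assume "A \<in> H"
    then have "A \<in> carrier Sp4Z \<or> - A \<in> carrier Sp4Z"
      using unshift_up_to_sign subgroup.mem_carrier[OF subgroup_G] by blast
    then show "A \<in> carrier Sp4Z"
      using Sp4C_uminus[of "- A"] by auto
  qed
  show "x \<otimes>\<^bsub>Sp4Z\<^esub> y \<in> H" if xy: "x \<in> H" "y \<in> H" for x y
  proof -
    obtain M N where "M \<in> monodromy_group (shift \<alpha> P) b (twist \<alpha> b f)" "x = C ** M ** matrix_inv C"
      "N \<in> monodromy_group (shift \<alpha> P) b (twist \<alpha> b f)" "y = C ** N ** matrix_inv C"
      using xy unfolding H_def conj_by_def by blast
    then show ?thesis
      using conj_mult[OF invertible_C, of M N] matrix_mult_mem_monodromy_group
      unfolding H_def conj_by_def by auto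
  qed
  show "\<one>\<^bsub>Sp4Z\<^esub> \<in> H"
  proof -
    have "mat 1 \<in> monodromy_group (shift \<alpha> P) b (twist \<alpha> b f)"
      using solution_basis_shift[OF P b f] b
      by (intro mat_1_mem_monodromy_group) (simp_all add: regular_locus_shift[OF P])
    moreover have "C ** mat 1 ** matrix_inv C = mat 1"
      using matrix_inv_right[OF invertible_C] by simp
    ultimately show ?thesis
      unfolding H_def conj_by_def by (simp, metis imageI)
  qed
  show "inv\<^bsub>Sp4Z\<^esub> x \<in> H" if x: "x \<in> H" for x
  proof -
    obtain M where M: "M \<in> monodromy_group (shift \<alpha> P) b (twist \<alpha> b f)" "x = C ** M ** matrix_inv C"
      using x unfolding H_def conj_by_def by blast
    \<comment> \<open>The inverse formed in Sp(4,Z), pulled back through \<open>C\<close>. It is a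
      right inverse of \<open>M\<close>, hence the matrix of the reversed loop.\<close>
    define N where "N = matrix_inv C ** (inv\<^bsub>Sp4Z\<^esub> x) ** C"
    have N: "C ** N ** matrix_inv C = inv\<^bsub>Sp4Z\<^esub> x"
      unfolding N_def by (rule conj_unconj[OF invertible_C])
    have "C ** (M ** N) ** matrix_inv C = x ** (inv\<^bsub>Sp4Z\<^esub> x)"
      unfolding conj_mult[OF invertible_C, symmetric] N M(2)[symmetric] ..
    also have "\<dots> = mat 1"
      using r_inv[of x] sub x by auto
    also have "\<dots> = C ** mat 1 ** matrix_inv C"
      using matrix_inv_right[OF invertible_C] by simp
    finally have "M ** N = mat 1"
      using conj_eq_iff[OF invertible_C] by blast
    then have "N \<in> monodromy_group (shift \<alpha> P) b (twist \<alpha> b f)"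
      using right_inverse_mem_monodromy_group M(1) by blast
    then show ?thesis
      unfolding H_def conj_by_def N[symmetric] by blast
  qed
qed

lemma sympl_identification_shift:
  "sympl_identification C (monodromy_group (shift \<alpha> P) b (twist \<alpha> b f))"
  using invertible_C subgroup_H zariski_dense_up_to_sign[OF dense_G shift_up_to_sign]
  unfolding sympl_identification_def H_def by blast

lemma finite_rcosets_shift:
  "finite (rcosets\<^bsub>Sp4Z\<^esub> G) \<Longrightarrow> finite (rcosets\<^bsub>Sp4Z\<^esub> H)"
  by (rule finite_rcosets_up_to_sign[OF subgroup_G subgroup_H shift_up_to_sign])

end

lemma symplectic_shift:
  assumes "symplectic P" "2 * \<alpha> \<in> \<int>"
  shows "symplectic (shift \<alpha> P)"
proof -
  have P: "order4_operator P" "fuchsian P" using assms by (simp_all add: symplectic_def)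
  have "\<exists>f C. solution_basis (shift \<alpha> P) b f \<and> sympl_identification C (monodromy_group (shift \<alpha> P) b f)"
    if b: "b \<in> regular_locus P" for b
    using assms(1) b solution_basis_shift[OF P(1) b] sympl_identification_shift[OF P(1) b _ assms(2)]
    unfolding symplectic_def by blast
  then show ?thesis
    using order4_operator_shift fuchsian_shift P by (simp add: symplectic_def regular_locus_shift)
qed

lemma arithmetic_shift:
  assumes P: "order4_operator P" and half: "2 * \<alpha> \<in> \<int>" and "arithmetic P"
  shows "arithmetic (shift \<alpha> P)"
proof -
  have "\<exists>f C. solution_basis (shift \<alpha> P) b f \<and> sympl_identification C (monodromy_group (shift \<alpha> P) b f) \<and>
      finite (rcosets\<^bsub>Sp4Z\<^esub> (conj_by C (monodromy_group (shift \<alpha> P) b f)))"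
    if b: "b \<in> regular_locus P" for b
  proof -
    obtain f C where "solution_basis P b f" "sympl_identification C (monodromy_group P b f)"
      "finite (rcosets\<^bsub>Sp4Z\<^esub> (conj_by C (monodromy_group P b f)))"
      using assms(3) b unfolding arithmetic_def by blast
    then show ?thesis
      using solution_basis_shift[OF P b] sympl_identification_shift[OF P b _ half]
        finite_rcosets_shift[OF P b _ half] by blast
  qed
  then show ?thesis
    by (simp add: arithmetic_def regular_locus_shift[OF P])
qed

section \<open>Local systems of solutions and the converse\<close>

lemma solution_basis_coordinates:
  assumes "solution_basis P b g" "\<And>i :: 4. local_solution P b (f i)"
  shows "\<exists>A :: complex^4^4. \<forall>i. \<forall>\<^sub>F z in nhds b. f i z = (\<Sum>k\<in>UNIV. A $ k $ i * g k z)"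
proof -
  have "\<forall>i. \<exists>c :: complex^4. \<forall>\<^sub>F z in nhds b. f i z = (\<Sum>k\<in>UNIV. c $ k * g k z)"
    using assms unfolding solution_basis_def by blast
  then obtain c :: "4 \<Rightarrow> complex^4" where c: "\<And>i. \<forall>\<^sub>F z in nhds b. f i z = (\<Sum>k\<in>UNIV. c i $ k * g k z)"
    by metis
  show ?thesis
    by (intro exI[of _ "\<chi> k i. c i $ k"]) (use c in simp)
qed

lemma lincomb_coordinates:
  fixes A :: "complex^4^4"
  assumes "\<And>i. \<forall>\<^sub>F z in nhds b. f i z = (\<Sum>k\<in>UNIV. A $ k $ i * g k z)"
  shows "\<forall>\<^sub>F z in nhds b. (\<Sum>i\<in>UNIV. c $ i * f i z) = (\<Sum>k\<in>UNIV. (A *v c) $ k * g k z)"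
proof -
  have "\<forall>\<^sub>F z in nhds b. \<forall>i. f i z = (\<Sum>k\<in>UNIV. A $ k $ i * g k z)"
    using assms by (simp add: eventually_all_finite)
  then show ?thesis
    by eventually_elim (simp add: lincomb_lincomb matrix_vector_mult_def)
qed

lemma solution_basis_unique:
  fixes c d :: "complex^4"
  assumes f: "solution_basis P b f" and y: "local_solution P b y"
    and "\<forall>\<^sub>F z in nhds b. y z = (\<Sum>i\<in>UNIV. c $ i * f i z)"
    and "\<forall>\<^sub>F z in nhds b. y z = (\<Sum>i\<in>UNIV. d $ i * f i z)"
  shows "c = d"
proof -
  have "\<exists>!c::complex^4. \<forall>\<^sub>F z in nhds b. y z = (\<Sum>i\<in>UNIV. c $ i * f i z)"
    using f y unfolding solution_basis_def by blast
  then show ?thesis using assms(3,4) by blast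
qed

lemma local_solution_0: "local_solution P b (\<lambda>_. 0)"
proof (rule local_solutionI[of UNIV])
  show "apply_op P (\<lambda>_. 0) z = 0" for z
    \<comment> \<open>The zero function is treated as an empty linear combination.\<close>
    using apply_op_sum[where S = UNIV and K = "{} :: nat set" and P = P and z = z] by simp
qed auto

lemma local_solutions_common_domain:
  fixes f :: "'i :: finite \<Rightarrow> complex \<Rightarrow> complex"
  assumes "\<And>i. local_solution P b (f i)"
  shows "\<exists>S. open S \<and> b \<in> S \<and> (\<forall>i. f i holomorphic_on S) \<and> (\<forall>i. \<forall>z\<in>S. apply_op P (f i) z = 0)"
proof -
  have "\<forall>i. \<exists>S. open S \<and> b \<in> S \<and> f i holomorphic_on S \<and> (\<forall>z\<in>S. apply_op P (f i) z = 0)"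
    using local_solutionE[OF assms] by metis
  then obtain S where S: "\<And>i. open (S i)" "\<And>i. b \<in> S i" "\<And>i. f i holomorphic_on S i"
    "\<And>i z. z \<in> S i \<Longrightarrow> apply_op P (f i) z = 0"
    by metis
  show ?thesis
  proof (intro exI[of _ "\<Inter>i. S i"] conjI allI)
    show "open (\<Inter>i. S i)" using S(1) by (intro open_INT) auto
    show "f i holomorphic_on (\<Inter>i. S i)" for i
      using S(3)[of i] by (rule holomorphic_on_subset) auto
  qed (use S in auto)
qed

lemma local_solution_lincomb:
  fixes f :: "'i :: finite \<Rightarrow> complex \<Rightarrow> complex"
  assumes "\<And>i. local_solution P b (f i)"
  shows "local_solution P b (\<lambda>z. \<Sum>i\<in>UNIV. c i * f i z)"
proof -
  obtain S where S: "open S" "b \<in> S" "\<And>i. f i holomorphic_on S" "\<And>i z. z \<in> S \<Longrightarrow> apply_op P (f i) z = 0"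
    using local_solutions_common_domain[where f = f, OF assms] by blast
  show ?thesis
  proof (rule local_solutionI[OF S(1,2)])
    show "apply_op P (\<lambda>z. \<Sum>i\<in>UNIV. c i * f i z) z = 0" if "z \<in> S" for z
      using apply_op_sum[OF S(1) _ that, where K = UNIV and P = P and c = c and f = f] S(3,4) that by simp
    show "(\<lambda>z. \<Sum>i\<in>UNIV. c i * f i z) holomorphic_on S"
      using S(3) by (intro holomorphic_intros)
  qed
qed

text \<open>
  A basis at \<open>c\<close> consists of four functions that stay independent near \<open>c\<close> by the identity theorem,
  and the solution space at every nearby point is four-dimensional by hypothesis.
\<close>

lemma solution_basis_nearby:
  assumes ex: "\<And>c. c \<in> regular_locus P \<Longrightarrow> \<exists>f. solution_basis P c f" and c: "c \<in> regular_locus P"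
  obtains f r where "r > 0" "\<And>i. f i holomorphic_on ball c r" "\<And>b. b \<in> ball c r \<Longrightarrow> solution_basis P b f"
proof -
  obtain f where f: "solution_basis P c f" using ex c by blast
  then have sol_c: "local_solution P c (f i)" for i by (simp add: solution_basis_def)
  obtain S where S: "open S" "c \<in> S" "\<And>i. f i holomorphic_on S" "\<And>i z. z \<in> S \<Longrightarrow> apply_op P (f i) z = 0"
    using local_solutions_common_domain[where f = f, OF sol_c] by blast
  have "open (S \<inter> regular_locus P)" "c \<in> S \<inter> regular_locus P"
    using S(1,2) open_regular_locus c by auto
  then obtain r where r: "r > 0" "ball c r \<subseteq> S \<inter> regular_locus P"
    using open_contains_ball by metis
  have hol: "f i holomorphic_on ball c r" for i
    using S(3)[of i] by (rule holomorphic_on_subset) (use r in auto)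
  have basis: "solution_basis P b f" if b: "b \<in> ball c r" for b
  proof -
    have sol: "local_solution P b (f i)" for i
      using r b S(4) hol by (intro local_solutionI[of "ball c r"]) auto
    obtain g where g: "solution_basis P b g" using ex r b by blast
    obtain A :: "complex^4^4" where A: "\<And>i. \<forall>\<^sub>F z in nhds b. f i z = (\<Sum>k\<in>UNIV. A $ k $ i * g k z)"
      using solution_basis_coordinates[of P b g f, OF g sol] by blast
    have "x = 0" if "A *v x = 0" for x
    proof -
      let ?y = "\<lambda>z. \<Sum>i\<in>UNIV. x $ i * f i z"
      have "\<forall>\<^sub>F z in nhds b. ?y z = 0"
        using lincomb_coordinates[OF A, of x] that by simp
      then obtain T where T: "open T" "b \<in> T" "\<And>z. z \<in> T \<Longrightarrow> ?y z = 0"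
        unfolding eventually_nhds by blast
      have "?y z = 0" if "z \<in> ball c r" for z
      proof (rule analytic_continuation_open[of "T \<inter> ball c r" "ball c r" ?y "\<lambda>_. 0"])
        show "?y holomorphic_on ball c r" using hol by (intro holomorphic_intros)
      qed (use T b that in auto)
      then have "\<forall>\<^sub>F z in nhds c. 0 = ?y z"
        using r(1) unfolding eventually_nhds by (intro exI[of _ "ball c r"]) auto
      then show "x = 0"
        by (intro solution_basis_unique[OF f local_solution_0]) auto
    qed
    then obtain B where BA: "B ** A = mat 1"
      using matrix_left_invertible_ker[of A] by blast
    then have AB: "A ** B = mat 1" using matrix_left_right_inverse by blast
    have "\<exists>!x::complex^4. \<forall>\<^sub>F z in nhds b. y z = (\<Sum>i\<in>UNIV. x $ i * f i z)" if y: "local_solution P b y" for y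
    proof -
      obtain d :: "complex^4" where d: "\<forall>\<^sub>F z in nhds b. y z = (\<Sum>k\<in>UNIV. d $ k * g k z)"
        using g y unfolding solution_basis_def by blast
      have iff: "(\<forall>\<^sub>F z in nhds b. y z = (\<Sum>i\<in>UNIV. x $ i * f i z)) \<longleftrightarrow> A *v x = d" for x
      proof
        assume "\<forall>\<^sub>F z in nhds b. y z = (\<Sum>i\<in>UNIV. x $ i * f i z)"
        then have "\<forall>\<^sub>F z in nhds b. y z = (\<Sum>k\<in>UNIV. (A *v x) $ k * g k z)"
          using lincomb_coordinates[OF A, of x] by eventually_elim simp
        then show "A *v x = d"
          using solution_basis_unique[OF g y _ d] by blast
      next
        assume "A *v x = d"
        then show "\<forall>\<^sub>F z in nhds b. y z = (\<Sum>i\<in>UNIV. x $ i * f i z)"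
          using d lincomb_coordinates[OF A, of x] by (auto elim: eventually_elim2)
      qed
      have "A *v x = d \<longleftrightarrow> x = B *v d" for x
        using AB BA by (metis matrix_vector_mul_assoc matrix_vector_mul_lid)
      then show ?thesis unfolding iff by simp
    qed
    then show ?thesis
      using sol unfolding solution_basis_def by blast
  qed
  show thesis using that[OF r(1) hol basis] .
qed

text \<open>Around each point of the path one basis is valid at every centre in a ball, so a
  solution there continues with constant coefficients. Bisection of the interval assembles these
  pieces.\<close>

lemma solution_continuation:
  assumes ex: "\<And>c. c \<in> regular_locus P \<Longrightarrow> \<exists>f. solution_basis P c f"
    and \<gamma>: "path \<gamma>" "path_image \<gamma> \<subseteq> regular_locus P" and y: "local_solution P (pathstart \<gamma>) y"
  obtains g where "local_solution P (pathfinish \<gamma>) g" "continues_along \<gamma> y g"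
proof -
  have cont: "continuous_on {0..1} \<gamma>" using \<gamma>(1) by (simp add: path_def)
  \<comment> \<open>The bounds form a premise because the local case of \<open>Bolzano\<close>
    ranges over all short intervals around a point, including those that leave
    \<open>{0..1}\<close>.\<close>
  define Q where "Q a b \<longleftrightarrow> (0 \<le> a \<and> a \<le> b \<and> b \<le> 1 \<longrightarrow>
    (\<forall>y. local_solution P (\<gamma> a) y \<longrightarrow> (\<exists>g. local_solution P (\<gamma> b) g \<and> cont_on \<gamma> a b y g)))" for a b :: real
  have QD: "\<exists>g. local_solution P (\<gamma> b) g \<and> cont_on \<gamma> a b y g"
    if "Q a b" "0 \<le> a" "a \<le> b" "b \<le> 1" "local_solution P (\<gamma> a) y" for a b y
    using that unfolding Q_def by blast
  have "(0 :: real) \<le> 1" by simp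
  then have "Q 0 1"
  proof (induction rule: Bolzano)
    case (trans a b c)
    have "\<exists>h. local_solution P (\<gamma> c) h \<and> cont_on \<gamma> a c y h"
      if a: "0 \<le> a" and c: "c \<le> 1" and y: "local_solution P (\<gamma> a) y" for y
    proof -
      have bounds: "0 \<le> b" "b \<le> 1" using a c trans(3,4) by simp_all
      obtain g where g: "local_solution P (\<gamma> b) g" "cont_on \<gamma> a b y g"
        using QD[OF trans(1) a trans(3) bounds(2) y] by blast
      obtain h where h: "local_solution P (\<gamma> c) h" "cont_on \<gamma> b c g h"
        using QD[OF trans(2) bounds(1) trans(4) c g(1)] by blast
      have "continuous_on {a..c} \<gamma>"
        using cont by (rule continuous_on_subset) (use a c in auto)
      then show ?thesis
        using cont_on_trans[OF g(2) h(2)] trans(3,4) h(1) by blast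
    qed
    then show ?case unfolding Q_def by blast
  next
    case (local x)
    have x: "x \<in> {0..1}" using local by simp
    then have "\<gamma> x \<in> regular_locus P" using \<gamma>(2) by (auto simp: path_image_def)
    then obtain f r where f: "r > 0" "\<And>i. f i holomorphic_on ball (\<gamma> x) r"
      "\<And>b. b \<in> ball (\<gamma> x) r \<Longrightarrow> solution_basis P b f"
      using solution_basis_nearby[OF ex] by metis
    obtain d where d: "d > 0" "\<And>s. s \<in> {0..1} \<Longrightarrow> dist s x < d \<Longrightarrow> dist (\<gamma> s) (\<gamma> x) < r"
      using cont x f(1) unfolding continuous_on_iff by metis
    have "Q a b" if ab: "a \<le> x" "x \<le> b" "b - a < d" for a b
      unfolding Q_def
    proof (intro impI allI)
      fix y assume bounds: "0 \<le> a \<and> a \<le> b \<and> b \<le> 1" and y: "local_solution P (\<gamma> a) y"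
      have mem: "\<gamma> s \<in> ball (\<gamma> x) r" if "s \<in> {a..b}" for s
        using d(2)[of s] that ab bounds by (auto simp: dist_real_def dist_commute)
      obtain c :: "complex^4" where c: "\<forall>\<^sub>F z in nhds (\<gamma> a). y z = (\<Sum>i\<in>UNIV. c $ i * f i z)"
        using f(3)[OF mem[of a]] y bounds unfolding solution_basis_def by fastforce
      let ?g = "\<lambda>z. \<Sum>i\<in>UNIV. c $ i * f i z"
      have g: "\<forall>\<^sub>F z in nhds (\<gamma> a). ?g z = y z"
        using c by eventually_elim simp
      have "?g holomorphic_on ball (\<gamma> x) r"
        using f(2) by (intro holomorphic_intros)
      then have "?g analytic_on {\<gamma> s}" if "s \<in> {a..b}" for s
        using mem[OF that] holomorphic_on_imp_analytic_at open_ball by blast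
      then have "cont_on \<gamma> a b ?g ?g"
        by (rule cont_on_const)
      then have "cont_on \<gamma> a b y ?g"
        by (rule cont_on_cong) (use g bounds in auto)
      moreover have "local_solution P (\<gamma> b) ?g"
        using f(3)[OF mem[of b]] bounds by (intro local_solution_lincomb) (auto simp: solution_basis_def)
      ultimately show "\<exists>g. local_solution P (\<gamma> b) g \<and> cont_on \<gamma> a b y g"
        by blast
    qed
    then show ?case using d(1) by blast
  qed
  then obtain g where "local_solution P (\<gamma> 1) g" "cont_on \<gamma> 0 1 y g"
    using QD[of 0 1 y] y by (auto simp: pathstart_def)
  then show thesis
    using that[of g] by (simp add: continues_along_iff pathfinish_def)
qed

lemma monodromy_along_exists:
  assumes ex: "\<And>c. c \<in> regular_locus P \<Longrightarrow> \<exists>f. solution_basis P c f"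
    and \<gamma>: "path \<gamma>" "path_image \<gamma> \<subseteq> regular_locus P" "pathstart \<gamma> = b" "pathfinish \<gamma> = b"
    and f: "solution_basis P b f"
  obtains M where "monodromy_along P b f \<gamma> M"
proof -
  have "\<exists>g. local_solution P b g \<and> continues_along \<gamma> (f j) g" for j
    using solution_continuation[OF ex \<gamma>(1,2), of "f j"] f \<gamma>(3,4) unfolding solution_basis_def by metis
  then obtain g where g: "\<And>j. local_solution P b (g j)" "\<And>j. continues_along \<gamma> (f j) (g j)"
    by metis
  obtain M :: "complex^4^4" where M: "\<And>j. \<forall>\<^sub>F z in nhds b. g j z = (\<Sum>i\<in>UNIV. M $ i $ j * f i z)"
    using solution_basis_coordinates[of P b f g, OF f g(1)] by blast
  have "continues_along \<gamma> (f j) (\<lambda>z. \<Sum>i\<in>UNIV. M $ i $ j * f i z)" for j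
    using g(2)[of j] M[of j] \<gamma>(4) unfolding continues_along_iff
    by (auto intro!: cont_on_cong[of \<gamma> 0 1 "f j" "g j"] simp: pathfinish_def)
  then show thesis
    using that \<gamma> unfolding monodromy_along_def by blast
qed

text \<open>Only finitely many points are excluded, so a circle about 0 of half the distance
  \<open>d\<close> meets none of them.\<close>

lemma loop_around_zero:
  obtains b \<gamma> where "path \<gamma>" "path_image \<gamma> \<subseteq> regular_locus P" "pathstart \<gamma> = b" "pathfinish \<gamma> = b"
    "\<And>\<alpha>. continues_along \<gamma> (powr_germ \<alpha> b) (\<lambda>z. multiplier \<alpha> * powr_germ \<alpha> b z)"
proof -
  obtain d where d: "d > 0" "\<And>a. a \<in> - regular_locus P \<Longrightarrow> a \<noteq> 0 \<Longrightarrow> d \<le> dist 0 a"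
    using finite_set_avoid[OF finite_compl_regular_locus[of P], of 0] by blast
  define b where "b = complex_of_real (d / 2)"
  \<comment> \<open>An explicit logarithm of the circle; it gains exactly
    \<open>2 * pi * \<i>\<close>, which makes the exponent of the multiplier equal to 1.\<close>
  define \<psi> where "\<psi> s = of_real (ln (d / 2)) + 2 * of_real pi * \<i> * of_real s" for s :: real
  define \<gamma> where "\<gamma> s = exp (\<psi> s)" for s
  have cont: "continuous_on {0..1} \<psi>"
    unfolding \<psi>_def by (intro continuous_intros)
  have start: "pathstart \<gamma> = b"
    using d(1) by (simp add: pathstart_def \<gamma>_def \<psi>_def b_def exp_of_real)
  have finish: "pathfinish \<gamma> = b"
    using d(1) by (simp add: pathfinish_def \<gamma>_def \<psi>_def b_def exp_of_real exp_add)
  have "path \<gamma>"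
    unfolding path_def \<gamma>_def using cont by (intro continuous_intros)
  moreover have "\<gamma> s \<in> regular_locus P" for s
  proof (rule ccontr)
    assume "\<gamma> s \<notin> regular_locus P"
    then have "d \<le> dist 0 (\<gamma> s)" using d(2)[of "\<gamma> s"] by (simp add: \<gamma>_def)
    also have "\<dots> = d / 2" using d(1) by (simp add: \<gamma>_def \<psi>_def)
    finally show False using d(1) by simp
  qed
  moreover have "continues_along \<gamma> (powr_germ \<alpha> b) (\<lambda>z. multiplier \<alpha> * powr_germ \<alpha> b z)" for \<alpha>
    using powr_germ_continues_along[OF cont, of \<gamma> \<alpha>] start finish
    by (simp add: \<gamma>_def \<psi>_def mult_ac)
  ultimately show thesis
    using that[of \<gamma> b] start finish by (auto simp: path_image_def)
qed

text \<open>A kernel vector of the coordinate matrix would represent the zero solution in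
  \<open>f\<close> a second time, so that matrix is invertible and conjugates loop by loop.\<close>

lemma monodromy_group_change_basis:
  assumes f: "solution_basis P b f" and g: "solution_basis P b g"
  obtains A where "invertible A"
    "\<And>M. M \<in> monodromy_group P b f \<Longrightarrow> A ** M ** matrix_inv A \<in> monodromy_group P b g"
proof -
  obtain A :: "complex^4^4" where A: "\<And>i. \<forall>\<^sub>F z in nhds b. f i z = (\<Sum>k\<in>UNIV. A $ k $ i * g k z)"
    using solution_basis_coordinates[OF g, of f] f by (auto simp: solution_basis_def)
  have "x = 0" if "A *v x = 0" for x
  proof -
    have "\<forall>\<^sub>F z in nhds b. 0 = (\<Sum>i\<in>UNIV. x $ i * f i z)"
      using lincomb_coordinates[OF A, of x] by eventually_elim (simp add: that)
    then show "x = 0"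
      by (intro solution_basis_unique[OF f local_solution_0]) auto
  qed
  then obtain B where BA: "B ** A = mat 1"
    using matrix_left_invertible_ker[of A] by blast
  then have AB: "A ** B = mat 1" using matrix_left_right_inverse by blast
  have inv: "invertible A" unfolding invertible_def using AB BA by blast
  have B: "matrix_inv A = B"
    using matrix_inv_left[OF inv] AB by (metis matrix_mul_assoc matrix_mul_lid matrix_mul_rid)
  have coord: "\<forall>\<^sub>F z in nhds b. (\<Sum>i\<in>UNIV. M $ i $ j * f i z) = (\<Sum>k\<in>UNIV. (A ** M) $ k $ j * g k z)"
    for M :: "complex^4^4" and j
    using lincomb_coordinates[OF A, of "\<chi> i. M $ i $ j"]
    by (simp add: matrix_vector_mult_def matrix_matrix_mult_def)
  have "A ** M ** B \<in> monodromy_group P b g" if "M \<in> monodromy_group P b f" for M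
  proof -
    obtain \<gamma> where \<gamma>: "monodromy_along P b f \<gamma> M"
      using \<open>M \<in> _\<close> monodromy_group_iff by blast
    have "continues_along \<gamma> (g j) (\<lambda>z. \<Sum>k\<in>UNIV. (A ** M ** B) $ k $ j * g k z)" for j
    proof -
      have "(\<Sum>k\<in>UNIV. mat 1 $ k $ j * g k z) = g j z" for z
        by (simp add: mat_def if_distrib[of "\<lambda>x. x * _"] cong: if_cong)
      then have start: "\<forall>\<^sub>F z in nhds b. (\<Sum>i\<in>UNIV. B $ i $ j * f i z) = g j z"
        using coord[of B j] by (simp add: AB)
      have fin: "\<forall>\<^sub>F z in nhds b. (\<Sum>i\<in>UNIV. (\<Sum>k\<in>UNIV. M $ i $ k * B $ k $ j) * f i z) =
          (\<Sum>k\<in>UNIV. (A ** M ** B) $ k $ j * g k z)"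
        using coord[of "M ** B" j] by (simp add: matrix_mul_assoc) (simp add: matrix_matrix_mult_def)
      have "continues_along \<gamma> (\<lambda>z. \<Sum>k\<in>UNIV. B $ k $ j * f k z)
          (\<lambda>z. \<Sum>i\<in>UNIV. (\<Sum>k\<in>UNIV. M $ i $ k * B $ k $ j) * f i z)"
        by (rule monodromy_along_continues_lincomb[OF \<gamma>])
      moreover have "\<gamma> 0 = b" "\<gamma> 1 = b"
        using \<gamma> by (auto simp: monodromy_along_def pathstart_def pathfinish_def)
      ultimately show ?thesis
        unfolding continues_along_iff using start fin by (auto intro: cont_on_cong)
    qed
    then show ?thesis
      using \<gamma> unfolding monodromy_group_iff monodromy_along_def by blast
  qed
  then show thesis using that[OF inv] B by simp
qed

section \<open>The multiplier of a symplectic shift\<close>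

lemma trace_Sp4Z: "A \<in> carrier Sp4Z \<Longrightarrow> trace A \<in> \<int>"
  by (auto simp: trace_def intro: Ints_sum)

lemma Ints_quotient_real:
  fixes c x :: complex
  assumes "c * x \<in> \<int>" "x \<in> \<int>" "x \<noteq> 0"
  shows "c \<in> \<real>"
proof -
  have "c * x / x \<in> \<real>"
    using assms(1,2) by (intro Reals_divide) (auto elim!: Ints_cases)
  then show ?thesis using assms(3) by simp
qed

lemma symplectic_shift_imp_half_integer:
  assumes symp: "symplectic P" and symp': "symplectic (shift \<alpha> P)"
  shows "2 * \<alpha> \<in> \<int>"
proof -
  have P: "order4_operator P" using symp by (simp add: symplectic_def)
  let ?\<mu> = "multiplier \<alpha>"
  obtain b \<gamma> where \<gamma>: "path \<gamma>" "path_image \<gamma> \<subseteq> regular_locus P" "pathstart \<gamma> = b" "pathfinish \<gamma> = b"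
    "\<And>\<alpha>. continues_along \<gamma> (powr_germ \<alpha> b) (\<lambda>z. multiplier \<alpha> * powr_germ \<alpha> b z)"
    using loop_around_zero by metis
  have b: "b \<in> regular_locus P" using \<gamma>(1-3) pathstart_in_path_image by blast
  obtain f C where f: "solution_basis P b f" "sympl_identification C (monodromy_group P b f)"
    using symp b unfolding symplectic_def by blast
  obtain g D where g: "solution_basis (shift \<alpha> P) b g"
    "sympl_identification D (monodromy_group (shift \<alpha> P) b g)"
    using symp' b unfolding symplectic_def regular_locus_shift[OF P] by blast
  let ?G = "monodromy_group P b f" and ?H = "monodromy_group (shift \<alpha> P) b (twist \<alpha> b f)"
  \<comment> \<open>\<open>g\<close> is whichever basis the hypothesis provides. \<open>A\<close>
    carries the twisted basis to it, and conjugation leaves traces and determinants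
    unchanged.\<close>
  obtain A where A: "invertible A"
    "\<And>M. M \<in> ?H \<Longrightarrow> A ** M ** matrix_inv A \<in> monodromy_group (shift \<alpha> P) b g"
    using monodromy_group_change_basis[OF solution_basis_shift[OF P b f(1)] g(1)] by blast
  have inv: "invertible C" "invertible D"
    using f(2) g(2) by (simp_all add: sympl_identification_def)
  have G: "C ** M ** matrix_inv C \<in> carrier Sp4Z" if "M \<in> ?G" for M
    using f(2) that subgroup.subset unfolding sympl_identification_def conj_by_def by blast
  have H: "D ** (A ** M ** matrix_inv A) ** matrix_inv D \<in> carrier Sp4Z" if "M \<in> ?H" for M
    using g(2) A(2)[OF that] subgroup.subset unfolding sympl_identification_def conj_by_def by blast
  have trG: "trace M \<in> \<int>" if "M \<in> ?G" for M
    using trace_Sp4Z[OF G[OF that]] by (simp add: trace_conj[OF inv(1)])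
  have trH: "trace M \<in> \<int>" if "M \<in> ?H" for M
    using trace_Sp4Z[OF H[OF that]] by (simp add: trace_conj[OF inv(2)] trace_conj[OF A(1)])

  have "\<exists>f. solution_basis P c f" if "c \<in> regular_locus P" for c
    using symp that unfolding symplectic_def by blast
  then obtain M\<^sub>0 where M\<^sub>0: "monodromy_along P b f \<gamma> M\<^sub>0"
    using monodromy_along_exists[OF _ \<gamma>(1-4) f(1)] by blast
  have M0G: "M\<^sub>0 \<in> ?G" using M\<^sub>0 monodromy_group_iff by blast
  have M0H: "mscale ?\<mu> M\<^sub>0 \<in> ?H"
    using monodromy_along_shift[OF P M\<^sub>0 \<gamma>(5)] monodromy_group_iff by blast
  let ?N = "C ** M\<^sub>0 ** matrix_inv C"

  have real: "?\<mu> \<in> \<real>"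
  proof (rule ccontr)
    assume nreal: "?\<mu> \<notin> \<real>"
    have van: "trace M * trace (M ** M\<^sub>0) = 0" if M: "M \<in> ?G" for M
    proof (rule ccontr)
      assume nz: "\<not> ?thesis"
      obtain n :: int where n: "mscale (?\<mu> powi n) M \<in> ?H"
        using monodromy_group_shift[OF P M] by blast
      have 1: "?\<mu> powi n \<in> \<real>"
        using Ints_quotient_real[of "?\<mu> powi n" "trace M"] trH[OF n] trG[OF M] nz
        by (simp add: trace_mscale)
      have "mscale (?\<mu> powi n) M ** mscale ?\<mu> M\<^sub>0 \<in> ?H"
        using matrix_mult_mem_monodromy_group n M0H by blast
      then have "trace (mscale (?\<mu> powi n) M ** mscale ?\<mu> M\<^sub>0) \<in> \<int>"
        by (rule trH)
      then have "(?\<mu> powi n * ?\<mu>) * trace (M ** M\<^sub>0) \<in> \<int>"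
        by (simp only: mscale_mult_left mscale_mult_right trace_mscale mult_ac)
      moreover have "trace (M ** M\<^sub>0) \<in> \<int>"
        using trG matrix_mult_mem_monodromy_group M M0G by blast
      ultimately have "?\<mu> powi n * ?\<mu> \<in> \<real>"
        using Ints_quotient_real nz by auto
      \<comment> \<open>The unknown exponent \<open>n\<close> cancels here.\<close>
      then have "(?\<mu> powi n * ?\<mu>) / ?\<mu> powi n \<in> \<real>"
        using 1 by (rule Reals_divide)
      then show False using nreal by simp
    qed
    have "trace X * trace (X ** ?N) = 0" if "X \<in> Sp4C" for X
    proof (rule zariski_closure_vanish[where X = "conj_by C ?G" and p = "\<lambda>X. trace X * trace (X ** ?N)"])
      show "X \<in> zariski_closure (conj_by C ?G)"
        using f(2) that unfolding sympl_identification_def by blast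
      have "polynomial_fun (\<lambda>A. trace A)"
        using polynomial_fun_trace_mult[of "mat 1"] by simp
      then show "polynomial_fun (\<lambda>X. trace X * trace (X ** ?N))"
        by (intro polynomial_fun.mult polynomial_fun_trace_mult)
      show "trace Y * trace (Y ** ?N) = 0" if Y: "Y \<in> conj_by C ?G" for Y
      proof -
        obtain M where M: "M \<in> ?G" "Y = C ** M ** matrix_inv C"
          using Y unfolding conj_by_def by blast
        show ?thesis
          using van[OF M(1)] unfolding M(2) conj_mult[OF inv(1)] trace_conj[OF inv(1)] .
      qed
    qed
    moreover have "?N \<in> Sp4C" using G[OF M0G] by simp
    ultimately show False using exists_nonzero_trace_product[of ?N] by auto
  qed

  have "det M\<^sub>0 ^ 2 = 1"
    using Sp4C_det[of ?N] G[OF M0G] by (simp add: det_conj[OF inv(1)])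
  moreover have "det (mscale ?\<mu> M\<^sub>0) ^ 2 = 1"
    using Sp4C_det[of "D ** (A ** mscale ?\<mu> M\<^sub>0 ** matrix_inv A) ** matrix_inv D"] H[OF M0H]
    by (simp add: det_conj[OF inv(2)] det_conj[OF A(1)])
  \<comment> \<open>Scaling a 4 by 4 matrix by \<open>\<mu>\<close> multiplies its determinant by
    \<open>\<mu>^4\<close>, and both determinants square to 1.\<close>
  ultimately have \<mu>8: "(?\<mu> ^ 4) ^ 2 = 1"
    by (simp add: det_mscale power_mult_distrib)
  obtain x where x: "?\<mu> = of_real x" using real by (auto elim: Reals_cases)
  \<comment> \<open>Passing to the nonnegative number \<open>x * x\<close> makes its fourth root
    unique.\<close>
  have "(x\<^sup>2) ^ 4 = 1 ^ 4"
    using \<mu>8 unfolding x by (simp flip: of_real_power power_mult)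
  then have "x\<^sup>2 = 1"
    by (rule power_eq_imp_eq_base) auto
  then have "?\<mu> ^ 2 = 1" unfolding x by (simp flip: of_real_power)
  then have "exp (2 * of_real pi * \<i> * (2 * \<alpha>)) = 1"
    by (simp add: power2_eq_square algebra_simps flip: exp_add)
  then obtain n :: int where n: "Re (2 * of_real pi * \<i> * (2 * \<alpha>)) = 0"
    "Im (2 * of_real pi * \<i> * (2 * \<alpha>)) = of_int (2 * n) * pi"
    unfolding exp_eq_1 by blast
  have "2 * \<alpha> = of_int n"
    using n by (simp add: complex_eq_iff)
  then show ?thesis by simp
qed

theorem theorem1:
  fixes P :: diffop and \<alpha> :: complex
  assumes "symplectic P"
  shows "(symplectic (shift \<alpha> P) \<longleftrightarrow> 2 * \<alpha> \<in> \<int>) \<and>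
         (2 * \<alpha> \<in> \<int> \<longrightarrow> (arithmetic P \<longleftrightarrow> arithmetic (shift \<alpha> P)))"
proof (intro conjI impI)
  show "symplectic (shift \<alpha> P) \<longleftrightarrow> 2 * \<alpha> \<in> \<int>"
    using assms symplectic_shift symplectic_shift_imp_half_integer by blast
  assume half: "2 * \<alpha> \<in> \<int>"
  then have half': "2 * (- \<alpha>) \<in> \<int>" by simp
  have P: "order4_operator P" using assms by (simp add: symplectic_def)
  show "arithmetic P \<longleftrightarrow> arithmetic (shift \<alpha> P)"
    using arithmetic_shift[OF P half] arithmetic_shift[OF order4_operator_shift[OF P] half', of \<alpha>] by auto
qed

end
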